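(* Let $s>0$ and let $G$ be a finite graph in which every edge has length at least $s$. Let $r=\mathrm{FvsNum}(G)$. Then for any $n\ge1$ agents with arbitrary monotone (continuous, nonnegative) valuations, there exists an $s$-separated allocation $(A_1,\dots,A_n)$ in which each $A_i$ is connected and $v_i(A_i)\ge\mathrm{MMS}_i^{n+r,s}$ for every $i\in[n]$.
   Context: Cake model: the cake is a finite undirected graph $G=(V,E)$, possibly disconnected, in which every edge is a segment of positive length; points of $G$ are its vertices and the points on its edges. A piece of cake is a finite union of intervals contained in edges, together possibly with some vertices. A piece $X$ is connected if any two points of $X$ can be joined by a path in $G$ that stays inside $X$. Each agent $i$ has a valuation $v_i$ on pieces that is nonnegative, monotone and continuous; in particular, points have value $0$. Distances: $\mathrm{Dist}^G(x,y)$ is the length of a shortest path along the edges, and is $\infty$ if $x$ and $y$ lie in different components. For sets, $\mathrm{Dist}^G(X,Y)=\inf_{x\in X,y\in Y}\mathrm{Dist}^G(x,y)$. Separation: a $k$-partition is $s$-separated if it consists of $k$ pairwise disjoint connected pieces $P_1,\dots,P_k$ with $\mathrm{Dist}^G(P_i,P_j)\ge s$ for all $i\ne j$. An $s$-separated allocation is a vector of connected pieces satisfying the same condition. Maximin share: $\mathrm{MMS}_i^{k,s}=\sup\min_{j\in[k]}v_i(P_j)$, where the supremum ranges over $s$-separated $k$-partitions. $\mathrm{FvsNum}(G)$ is the minimum number of vertices whose removal from $G$ leaves an acyclic graph. *)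

theory Defs
  imports "HOL-Analysis.Analysis"
begin

text \<open>A metric graph: finite vertex set V, edge set E of ordered pairs (each undirected
edge stored once, with an arbitrary orientation), edge lengths len.\<close>

datatype 'v point = Vtx 'v | EPt "'v \<times> 'v" real

definition metric_graph :: "'v set \<Rightarrow> ('v \<times> 'v) set \<Rightarrow> ('v \<times> 'v \<Rightarrow> real) \<Rightarrow> bool" where
  "metric_graph V E len \<longleftrightarrow> finite V \<and> E \<subseteq> V \<times> V \<and>
     (\<forall>(a,b)\<in>E. a \<noteq> b \<and> (b,a) \<notin> E) \<and> (\<forall>e\<in>E. len e > 0)"

text \<open>Points of the cake: vertices, and interior points EPt e t (0 < t < len e) of edges;
the point at parameter t of edge (a,b) is at distance t from a.\<close>
definition cake_points :: "'v set \<Rightarrow> ('v \<times> 'v) set \<Rightarrow> ('v \<times> 'v \<Rightarrow> real) \<Rightarrow> 'v point set" where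
  "cake_points V E len = {Vtx u | u. u \<in> V} \<union> {EPt e t | e t. e \<in> E \<and> 0 < t \<and> t < len e}"

text \<open>A piece: finite union of intervals contained in edges, together with some vertices.\<close>
definition is_piece :: "'v set \<Rightarrow> ('v \<times> 'v) set \<Rightarrow> ('v \<times> 'v \<Rightarrow> real) \<Rightarrow> 'v point set \<Rightarrow> bool" where
  "is_piece V E len X \<longleftrightarrow> X \<subseteq> cake_points V E len \<and>
     (\<forall>e\<in>E. \<exists>F. finite F \<and> (\<forall>I\<in>F. is_interval (I :: real set)) \<and> {t. EPt e t \<in> X} = \<Union>F)"

text \<open>The point at parameter t \<in> [0, len e] of edge e (endpoints are the vertices).\<close>
definition edge_pt :: "('v \<times> 'v \<Rightarrow> real) \<Rightarrow> 'v \<times> 'v \<Rightarrow> real \<Rightarrow> 'v point" where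
  "edge_pt len e t = (if t = 0 then Vtx (fst e) else if t = len e then Vtx (snd e) else EPt e t)"

definition seg_in :: "('v \<times> 'v \<Rightarrow> real) \<Rightarrow> 'v point set \<Rightarrow> 'v \<times> 'v \<Rightarrow> real \<Rightarrow> real \<Rightarrow> bool" where
  "seg_in len X e t t' \<longleftrightarrow> t \<in> {0..len e} \<and> t' \<in> {0..len e} \<and>
     (\<forall>u \<in> closed_segment t t'. edge_pt len e u \<in> X)"

text \<open>Moving along a segment of an edge that stays inside X.\<close>
definition path_step :: "('v \<times> 'v) set \<Rightarrow> ('v \<times> 'v \<Rightarrow> real) \<Rightarrow> 'v point set \<Rightarrow> ('v point \<times> 'v point) set" where
  "path_step E len X = {(edge_pt len e t, edge_pt len e t') | e t t'. e \<in> E \<and> seg_in len X e t t'}"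

text \<open>X is connected: any two points of X are joined by a path in G staying inside X.\<close>
definition connected_piece :: "('v \<times> 'v) set \<Rightarrow> ('v \<times> 'v \<Rightarrow> real) \<Rightarrow> 'v point set \<Rightarrow> bool" where
  "connected_piece E len X \<longleftrightarrow> (\<forall>x\<in>X. \<forall>y\<in>X. (x, y) \<in> (path_step E len X)\<^sup>*)"

text \<open>Walks between vertices with their total length.\<close>
inductive walk :: "('v \<times> 'v) set \<Rightarrow> ('v \<times> 'v \<Rightarrow> real) \<Rightarrow> 'v \<Rightarrow> 'v \<Rightarrow> real \<Rightarrow> bool"
  for E len where
  walk_nil: "walk E len u u 0"
| walk_fwd: "(a, b) \<in> E \<Longrightarrow> walk E len b c L \<Longrightarrow> walk E len a c (len (a, b) + L)"
| walk_bwd: "(b, a) \<in> E \<Longrightarrow> walk E len b c L \<Longrightarrow> walk E len a c (len (b, a) + L)"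

definition vdist :: "('v \<times> 'v) set \<Rightarrow> ('v \<times> 'v \<Rightarrow> real) \<Rightarrow> 'v \<Rightarrow> 'v \<Rightarrow> ennreal" where
  "vdist E len u w = Inf {ennreal L | L. walk E len u w L}"

text \<open>Vertices from which a point can be reached, with the distance along its edge.\<close>
fun anchors :: "('v \<times> 'v \<Rightarrow> real) \<Rightarrow> 'v point \<Rightarrow> ('v \<times> real) set" where
  "anchors len (Vtx u) = {(u, 0)}"
| "anchors len (EPt e t) = {(fst e, t), (snd e, len e - t)}"

fun direct_dist :: "'v point \<Rightarrow> 'v point \<Rightarrow> ennreal" where
  "direct_dist (EPt e t) (EPt e' t') = (if e = e' then ennreal \<bar>t - t'\<bar> else \<infinity>)"
| "direct_dist _ _ = \<infinity>"

text \<open>Shortest-path distance between points (\<infinity> if in different components).\<close>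
definition pdist :: "('v \<times> 'v) set \<Rightarrow> ('v \<times> 'v \<Rightarrow> real) \<Rightarrow> 'v point \<Rightarrow> 'v point \<Rightarrow> ennreal" where
  "pdist E len x y = min (direct_dist x y)
     (INF ap \<in> anchors len x. INF bq \<in> anchors len y.
        ennreal (snd ap) + vdist E len (fst ap) (fst bq) + ennreal (snd bq))"

definition Dist :: "('v \<times> 'v) set \<Rightarrow> ('v \<times> 'v \<Rightarrow> real) \<Rightarrow> 'v point set \<Rightarrow> 'v point set \<Rightarrow> ennreal" where
  "Dist E len X Y = (INF x \<in> X. INF y \<in> Y. pdist E len x y)"

text \<open>s-separated family of k connected pieces P 0, ..., P (k-1).\<close>
definition sep_family :: "'v set \<Rightarrow> ('v \<times> 'v) set \<Rightarrow> ('v \<times> 'v \<Rightarrow> real) \<Rightarrow> real \<Rightarrow> nat \<Rightarrow> (nat \<Rightarrow> 'v point set) \<Rightarrow> bool" where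
  "sep_family V E len s k P \<longleftrightarrow>
     (\<forall>j<k. is_piece V E len (P j) \<and> connected_piece E len (P j)) \<and>
     (\<forall>i<k. \<forall>j<k. i \<noteq> j \<longrightarrow> P i \<inter> P j = {} \<and> ennreal s \<le> Dist E len (P i) (P j))"

definition MMS :: "'v set \<Rightarrow> ('v \<times> 'v) set \<Rightarrow> ('v \<times> 'v \<Rightarrow> real) \<Rightarrow> ('v point set \<Rightarrow> real) \<Rightarrow> nat \<Rightarrow> real \<Rightarrow> real" where
  "MMS V E len v k s = Sup {Min ((\<lambda>j. v (P j)) ` {..<k}) | P. sep_family V E len s k P}"

text \<open>Total length (Lebesgue measure) of the edge part of a set of points.\<close>
definition piece_len :: "('v \<times> 'v) set \<Rightarrow> 'v point set \<Rightarrow> real" where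
  "piece_len E X = (\<Sum>e\<in>E. measure lborel {t. EPt e t \<in> X})"

definition valuation :: "'v set \<Rightarrow> ('v \<times> 'v) set \<Rightarrow> ('v \<times> 'v \<Rightarrow> real) \<Rightarrow> ('v point set \<Rightarrow> real) \<Rightarrow> bool" where
  "valuation V E len v \<longleftrightarrow>
     (\<forall>X. is_piece V E len X \<longrightarrow> 0 \<le> v X) \<and>
     (\<forall>X Y. is_piece V E len X \<and> is_piece V E len Y \<and> X \<subseteq> Y \<longrightarrow> v X \<le> v Y) \<and>
     (\<forall>p \<in> cake_points V E len. v {p} = 0) \<and>
     (\<forall>X. is_piece V E len X \<longrightarrow> (\<forall>\<epsilon>>0. \<exists>\<delta>>0. \<forall>Y. is_piece V E len Y \<longrightarrow>
        piece_len E ((X - Y) \<union> (Y - X)) < \<delta> \<longrightarrow> \<bar>v X - v Y\<bar> < \<epsilon>))"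

text \<open>Feedback vertex set number.\<close>
definition adj :: "('v \<times> 'v) set \<Rightarrow> 'v \<Rightarrow> 'v \<Rightarrow> bool" where
  "adj E u w \<longleftrightarrow> (u, w) \<in> E \<or> (w, u) \<in> E"

definition is_cycle :: "('v \<times> 'v) set \<Rightarrow> 'v set \<Rightarrow> 'v list \<Rightarrow> bool" where
  "is_cycle E W cs \<longleftrightarrow> distinct cs \<and> length cs \<ge> 3 \<and> set cs \<subseteq> W \<and>
     (\<forall>i < length cs. adj E (cs ! i) (cs ! ((i + 1) mod length cs)))"

definition FvsNum :: "'v set \<Rightarrow> ('v \<times> 'v) set \<Rightarrow> nat" where
  "FvsNum V E = Min (card ` {S. S \<subseteq> V \<and> \<not> (\<exists>cs. is_cycle E (V - S) cs)})"

end

(* Let S be a vertex set with acyclic complement and |S| = FvsNum(G). At most one piece of an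
   s-separated partition meets the open ball of radius s/2 around a given vertex of S, so each agent
   keeps at least n pieces of an optimal (n + |S|)-partition (which exists by compactness) that avoid
   all these balls. As edges have length at least s, on the remaining part of the cake, a forest,
   being at distance less than s has the same meaning in G and in the forest.

   Root the forest and repeatedly give away the available piece P whose highest point is deepest.
   If two pieces Q, Q' of another agent were both at distance less than s from P, then, as both reach
   at least as high as P, one could replace P by its highest point x and Q, Q' by points not
   deeper than x; the path from Q to Q' turning at the higher of the two turning points would then be
   no longer than the path from x to one of them, contradicting that Q and Q' are s-separated. So every
   other agent loses at most one piece per round. *)
theory Submission
  imports Defs
begin

section \<open>Pieces on an edge and pointwise limits\<close>

text \<open>Pieces need not be closed, and this shapes both halves of the argument. Limits of
  partitions are therefore taken pointwise, in the compact space of membership predicates.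
  Connectedness survives because joining two points involves only finitely many segments. Values
  survive because a connected piece meets an edge in at most two intervals, so agreement on a fine
  grid bounds the length of a symmetric difference uniformly over all pieces. In the forest a piece
  may lack a highest point; the infimum of its depths replaces it, at the price of an \<epsilon>
  that the strict inequality \<open>L < s\<close> absorbs. Cutting out only the vertices of
  \<open>S\<close> keeps the edges at them: the inside of such an edge hangs as a stub from its
  other end, or forms a component of its own if both ends lie in \<open>S\<close>.\<close>

lemma cluster_point:
  fixes \<sigma> :: "nat \<Rightarrow> 'a \<Rightarrow> bool"
  shows "\<exists>\<tau>. \<forall>F N. finite F \<longrightarrow> (\<exists>m\<ge>N. \<forall>x\<in>F. \<sigma> m x = \<tau> x)"
proof -
  \<comment> \<open>Tychonoff on a Boolean cube. The index set will be uncountable, so no pointwise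
    convergent subsequence is to be expected; a cluster point, approached on finite sets only,
    always exists.\<close>
  define T where "T = product_topology (\<lambda>_::'a. discrete_topology (UNIV :: bool set)) UNIV"
  have top: "topspace T = UNIV" by (simp add: T_def PiE_UNIV_domain)
  have "compact_space T"
    unfolding T_def by (simp add: compact_space_product_topology compact_space_discrete_topology)
  define C where "C N = T closure_of (\<sigma> ` {N..})" for N
  have "\<Inter> (range C) \<noteq> {}"
  proof -
    have "\<Inter>\<F> \<noteq> {}" if "finite \<F>" "\<F> \<subseteq> range C" for \<F>
    proof -
      obtain I where I: "finite I" "\<F> = C ` I"
        using finite_subset_image[of \<F> C UNIV] \<open>finite \<F>\<close> \<open>\<F> \<subseteq> range C\<close> by blast
      have "\<sigma> (Max (insert 0 I)) \<in> C N" if "N \<in> I" for N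
      proof -
        have "\<sigma> (Max (insert 0 I)) \<in> \<sigma> ` {N..}" using that I by auto
        then show ?thesis
          using closure_of_subset[of "\<sigma> ` {N..}" T] by (auto simp: C_def top)
      qed
      then show ?thesis using I by auto
    qed
    then show ?thesis
      using \<open>compact_space T\<close>[unfolded compact_space_fip, rule_format, of "range C"]
      by (auto simp: C_def)
  qed
  then obtain \<tau> where \<tau>: "\<And>N. \<tau> \<in> C N" by auto
  have "\<exists>m\<ge>N. \<forall>x\<in>F. \<sigma> m x = \<tau> x" if "finite F" for F N
  proof -
    define U where "U = PiE UNIV (\<lambda>x. if x \<in> F then {\<tau> x} else UNIV)"
    have "finite {x. (if x \<in> F then {\<tau> x} else UNIV) \<noteq> UNIV}"
      by (rule finite_subset[OF _ that]) auto
    then have "openin T U"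
      unfolding T_def U_def by (intro product_topology_basis) auto
    moreover have "\<tau> \<in> U" by (auto simp: U_def)
    ultimately obtain y where "y \<in> \<sigma> ` {N..}" "y \<in> U"
      using \<tau>[of N] unfolding C_def in_closure_of by meson
    then show ?thesis by (auto simp: U_def PiE_iff split: if_splits)
  qed
  then show ?thesis by blast
qed

lemma closed_segment_trans_real:
  fixes a b c :: real
  shows "closed_segment a c \<subseteq> closed_segment a b \<union> closed_segment b c"
  by (auto simp: closed_segment_eq_real_ivl split: if_splits)

lemma seg_in_trans: "seg_in len X e a b \<Longrightarrow> seg_in len X e b c \<Longrightarrow> seg_in len X e a c"
  using closed_segment_trans_real[of a c b] by (auto simp: seg_in_def)

lemma edge_pt_eq_EPt_iff:
  "t \<in> {0..len e} \<Longrightarrow> edge_pt len e t = EPt e' t' \<longleftrightarrow> e = e' \<and> t = t' \<and> 0 < t \<and> t < len e"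
  by (auto simp: edge_pt_def)

text \<open>Only finitely many segments matter for joining two given points, which is what makes
  connectedness pass to pointwise limits.\<close>
lemma grid_path:
  assumes xy: "(x, y) \<in> (path_step E len X)\<^sup>*"
    and ends: "\<And>e. e \<in> E \<Longrightarrow> {0, len e} \<subseteq> \<Gamma> e"
    and grid: "\<And>e t. EPt e t \<in> {x, y} \<Longrightarrow> t \<in> \<Gamma> e"
  shows "(x, y) \<in> {(edge_pt len e t, edge_pt len e t') | e t t'.
    e \<in> E \<and> t \<in> \<Gamma> e \<and> t' \<in> \<Gamma> e \<and> seg_in len X e t t'}\<^sup>*"
proof -
  define G where "G = {(edge_pt len e t, edge_pt len e t') | e t t'.
    e \<in> E \<and> t \<in> \<Gamma> e \<and> t' \<in> \<Gamma> e \<and> seg_in len X e t t'}"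
  have GI: "(edge_pt len e t, edge_pt len e t') \<in> G"
    if "e \<in> E" "t \<in> \<Gamma> e" "t' \<in> \<Gamma> e" "seg_in len X e t t'" for e t t'
    using that unfolding G_def by blast
  have on_grid: "t \<in> \<Gamma> e" if "e \<in> E" "edge_pt len e t = z" "\<And>e t. z = EPt e t \<Longrightarrow> t \<in> \<Gamma> e" for e t z
    using that ends by (auto simp: edge_pt_def split: if_splits)
  \<comment> \<open>Invariant: grid moves lead to a last grid point \<open>g\<close>, and one
    pending segment leads from there to \<open>z\<close>. It is stated for every edge through
    \<open>z\<close>, because at a vertex, where the pending segment ends on the grid, the path may
    turn into another edge.\<close>
  have "\<forall>e\<in>E. \<forall>t\<in>{0..len e}. z = edge_pt len e t \<and> z \<in> X \<longrightarrow>
      (\<exists>g\<in>\<Gamma> e. (x, edge_pt len e g) \<in> G\<^sup>* \<and> seg_in len X e g t)"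
    if "(x, z) \<in> (path_step E len X)\<^sup>*" for z
    using that
  proof (induction rule: rtrancl_induct)
    case base
    show ?case
    proof (intro ballI impI)
      fix e t assume "e \<in> E" "t \<in> {0..len e}" "x = edge_pt len e t \<and> x \<in> X"
      then show "\<exists>g\<in>\<Gamma> e. (x, edge_pt len e g) \<in> G\<^sup>* \<and> seg_in len X e g t"
        using on_grid[of e t x] grid by (intro bexI[of _ t]) (auto simp: seg_in_def)
    qed
  next
    case (step z z')
    from step(2) obtain e t t' where st: "e \<in> E" "seg_in len X e t t'" "z = edge_pt len e t"
      "z' = edge_pt len e t'" by (auto simp: path_step_def)
    then have t: "t \<in> {0..len e}" "t' \<in> {0..len e}" "z \<in> X" "z' \<in> X" by (auto simp: seg_in_def)
    obtain g where g: "g \<in> \<Gamma> e" "(x, edge_pt len e g) \<in> G\<^sup>*" "seg_in len X e g t"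
      using step(3)[rule_format, OF st(1) t(1)] st(3) t(3) by blast
    have gt': "seg_in len X e g t'" using seg_in_trans[OF g(3) st(2)] .
    show ?case
    proof (intro ballI impI)
      fix e2 t2 assume a: "e2 \<in> E" "t2 \<in> {0..len e2}" "z' = edge_pt len e2 t2 \<and> z' \<in> X"
      show "\<exists>g\<in>\<Gamma> e2. (x, edge_pt len e2 g) \<in> G\<^sup>* \<and> seg_in len X e2 g t2"
      proof (cases "\<exists>u. z' = Vtx u")
        case True
        then have "t' \<in> \<Gamma> e" "t2 \<in> \<Gamma> e2"
          using on_grid[of e t' z'] on_grid[of e2 t2 z'] a st by auto
        then have "(edge_pt len e g, z') \<in> G" using GI[OF st(1) g(1) _ gt'] st(4) by simp
        then have "(x, z') \<in> G\<^sup>*" using g by auto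
        then show ?thesis using a \<open>t2 \<in> \<Gamma> e2\<close> by (intro bexI[of _ t2]) (auto simp: seg_in_def)
      next
        case False
        then have "e2 = e \<and> t2 = t'" using a st t by (auto simp: edge_pt_def split: if_splits)
        then show ?thesis using g gt' by auto
      qed
    qed
  qed
  note inv = this
  show ?thesis
  proof (cases "x = y")
    case False
    then obtain z where z: "(x, z) \<in> (path_step E len X)\<^sup>*" "(z, y) \<in> path_step E len X"
      using xy by (meson rtranclE)
    then obtain e t t' where st: "e \<in> E" "seg_in len X e t t'" "z = edge_pt len e t"
      "y = edge_pt len e t'" by (auto simp: path_step_def)
    then have t': "t' \<in> {0..len e}" "y \<in> X" by (auto simp: seg_in_def)
    then obtain g where g: "g \<in> \<Gamma> e" "(x, edge_pt len e g) \<in> G\<^sup>*" "seg_in len X e g t'"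
      using inv[OF xy, rule_format, OF st(1) t'(1)] st(4) by blast
    moreover have "t' \<in> \<Gamma> e" using on_grid[of e t' y] st grid by auto
    ultimately have "(edge_pt len e g, y) \<in> G" using GI[OF st(1), of g t'] st(4) by simp
    then show ?thesis using g unfolding G_def by (meson rtrancl.rtrancl_into_rtrancl)
  qed auto
qed

text \<open>A path in \<open>X\<close> from the point at \<open>c\<close> can leave the open stretch
  between \<open>b\<close> and \<open>d\<close> only through \<open>b\<close> or \<open>d\<close>.
  The bounds \<open>0 < b\<close> and \<open>d < len e\<close> keep both gaps off the
  vertices.\<close>

lemma connected_piece_gap:
  assumes conn: "connected_piece E len X" and "b < c" "c < d"
    and c: "EPt e c \<in> X" and bd: "EPt e b \<notin> X" "EPt e d \<notin> X" and x: "x \<in> X" and bd': "0 < b" "d < len e"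
  shows "\<exists>u. b < u \<and> u < d \<and> x = EPt e u"
proof -
  have "(EPt e c, x) \<in> (path_step E len X)\<^sup>*" using conn c x by (auto simp: connected_piece_def)
  then show ?thesis
  proof (induction rule: rtrancl_induct)
    case base
    then show ?case using assms by auto
  next
    case (step z z')
    then obtain u where u: "b < u" "u < d" "z = EPt e u" by auto
    from step(2) obtain e' t t' where st: "seg_in len X e' t t'" "z = edge_pt len e' t"
      "z' = edge_pt len e' t'" by (auto simp: path_step_def)
    then have "e' = e" "t = u" using u edge_pt_eq_EPt_iff[of t len e' e u] by (auto simp: seg_in_def)
    have "edge_pt len e b \<notin> X" "edge_pt len e d \<notin> X" using assms by (auto simp: edge_pt_def)
    then have "b \<notin> closed_segment u t'" "d \<notin> closed_segment u t'"
      using st \<open>e' = e\<close> \<open>t = u\<close> by (auto simp: seg_in_def)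
    then have "b < t'" "t' < d" using u by (auto simp: closed_segment_eq_real_ivl split: if_splits)
    then show ?case using st \<open>e' = e\<close> bd' by (auto simp: edge_pt_def)
  qed
qed

text \<open>Two intervals do occur: a piece may enter an edge from both ends by going round a cycle.
  A further interval would lie between two gaps, which cut it off from the rest of
  \<open>X\<close>.\<close>

lemma connected_piece_two_intervals:
  assumes conn: "connected_piece E len X" and X: "X \<subseteq> cake_points V E len"
  shows "\<exists>I J. is_interval I \<and> is_interval J \<and> {t. EPt e t \<in> X} = I \<union> (J :: real set)"
proof -
  define A where "A = {t. EPt e t \<in> X}"
  have A: "0 < t \<and> t < len e" if "t \<in> A" for t using that X by (auto simp: A_def cake_points_def)
  have gap: "b < x \<and> x < d" if "b < c" "c < d" "c \<in> A" "b \<notin> A" "d \<notin> A" "x \<in> A" "0 < b" "d < len e" for b c d x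
    using connected_piece_gap[OF conn that(1,2), of e "EPt e x"] that by (auto simp: A_def)
  show ?thesis
  proof (cases "is_interval A")
    case True
    then show ?thesis by (intro exI[of _ A] exI[of _ A]) (auto simp: A_def)
  next
    case False
    then obtain a b c where abc: "a \<in> A" "c \<in> A" "a \<le> b" "b \<le> c" "b \<notin> A"
      by (auto simp: is_interval_1)
    then have b: "a < b" "b < c" by (auto simp: less_le)
    have "is_interval (A \<inter> {..<b})"
      unfolding is_interval_1
    proof (intro allI ballI impI)
      fix x y z assume *: "x \<in> A \<inter> {..<b}" "y \<in> A \<inter> {..<b}" "x \<le> z \<and> z \<le> y"
      show "z \<in> A \<inter> {..<b}"
      proof (rule ccontr)
        assume "z \<notin> A \<inter> {..<b}"
        then have "z \<notin> A" using * by auto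
        then have "x < z" "z < y" using * by (auto simp: less_le)
        then show False using gap[of z y b c] * abc b \<open>z \<notin> A\<close> A[of x] A[of c] by auto
      qed
    qed
    moreover have "is_interval (A \<inter> {b<..})"
      unfolding is_interval_1
    proof (intro allI ballI impI)
      fix x y z assume *: "x \<in> A \<inter> {b<..}" "y \<in> A \<inter> {b<..}" "x \<le> z \<and> z \<le> y"
      show "z \<in> A \<inter> {b<..}"
      proof (rule ccontr)
        assume "z \<notin> A \<inter> {b<..}"
        then have "z \<notin> A" using * by auto
        then have "x < z" "z < y" using * by (auto simp: less_le)
        then show False using gap[of b x z a] * abc b \<open>z \<notin> A\<close> A[of y] A[of a] by auto
      qed
    qed
    moreover have "A = (A \<inter> {..<b}) \<union> (A \<inter> {b<..})" using abc(5) by (auto simp: not_less_iff_gr_or_eq)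
    ultimately show ?thesis unfolding A_def by blast
  qed
qed

text \<open>Lets a limit of pieces be recognised as a piece once its connectedness is known.\<close>

lemma connected_is_piece:
  assumes "connected_piece E len X" "X \<subseteq> cake_points V E len"
  shows "is_piece V E len X"
  unfolding is_piece_def
proof (intro conjI ballI)
  fix e
  obtain I J where "is_interval I" "is_interval J" "{t. EPt e t \<in> X} = I \<union> (J :: real set)"
    using connected_piece_two_intervals[OF assms] by blast
  then show "\<exists>F. finite F \<and> (\<forall>I\<in>F. is_interval (I :: real set)) \<and> {t. EPt e t \<in> X} = \<Union>F"
    by (intro exI[of _ "{I, J}"]) auto
qed (rule assms)

section \<open>Grid estimates for the length of a symmetric difference\<close>

definition mixed_cells :: "real \<Rightarrow> nat \<Rightarrow> real set \<Rightarrow> nat set" where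
  "mixed_cells \<eta> N A = {i. i < N \<and> (\<exists>x\<in>{real i*\<eta>..real (Suc i)*\<eta>}. \<exists>y\<in>{real i*\<eta>..real (Suc i)*\<eta>}. x \<in> A \<and> y \<notin> A)}"

text \<open>A mixed cell strictly between the first and the last one would contain a non-member
  lying between two members.\<close>

lemma card_mixed_cells_interval:
  assumes "is_interval I" "\<eta> > 0"
  shows "card (mixed_cells \<eta> N I) \<le> 2"
proof (cases "mixed_cells \<eta> N I = {}")
  case False
  define M where "M = mixed_cells \<eta> N I"
  have fin: "finite M" by (simp add: M_def mixed_cells_def)
  have "M \<subseteq> {Min M, Max M}"
  proof
    fix j assume j: "j \<in> M"
    show "j \<in> {Min M, Max M}"
    proof (rule ccontr)
      assume "j \<notin> {Min M, Max M}"
      then have "Min M < j" "j < Max M" using j fin by (auto simp: less_le)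
      moreover have "Min M \<in> M" "Max M \<in> M" using False fin by (auto simp: M_def)
      ultimately obtain x y z where "x \<le> real (Suc (Min M)) * \<eta>" "x \<in> I" "y \<ge> real (Max M) * \<eta>" "y \<in> I"
        "z \<notin> I" "real j * \<eta> \<le> z" "z \<le> Suc j * \<eta>"
        using j by (force simp: M_def mixed_cells_def)
      moreover have "real (Suc (Min M)) * \<eta> \<le> real j * \<eta>" "Suc j * \<eta> \<le> real (Max M) * \<eta>"
        using \<open>Min M < j\<close> \<open>j < Max M\<close> assms(2) by (auto intro!: mult_right_mono simp del: of_nat_Suc)
      ultimately show False using assms(1) unfolding is_interval_1
        by (meson order_trans)
    qed
  qed
  then have "card M \<le> card {Min M, Max M}" by (intro card_mono) auto
  also have "\<dots> \<le> 2" by (simp add: card_insert_if)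
  finally show ?thesis by (simp add: M_def)
qed auto

lemma card_mixed_cells_Un:
  "card (mixed_cells \<eta> N (I \<union> J)) \<le> card (mixed_cells \<eta> N I) + card (mixed_cells \<eta> N J)"
proof -
  have "card (mixed_cells \<eta> N (I \<union> J)) \<le> card (mixed_cells \<eta> N I \<union> mixed_cells \<eta> N J)"
    by (intro card_mono) (auto simp: mixed_cells_def)
  then show ?thesis using card_Un_le le_trans by blast
qed

text \<open>The left end of a cell belongs to both sets or to neither. A point of the symmetric
  difference therefore differs from it in membership in \<open>A\<close> or in \<open>B\<close>, and
  its cell is mixed for that set.\<close>

lemma measure_sym_diff_le:
  fixes A B :: "real set" and \<eta> :: real
  assumes "\<eta> > 0" "A \<subseteq> {0..real N*\<eta>}" "B \<subseteq> {0..real N*\<eta>}"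
    and agree: "\<And>i. i \<le> N \<Longrightarrow> real i*\<eta> \<in> A \<longleftrightarrow> real i*\<eta> \<in> B"
  shows "measure lborel ((A - B) \<union> (B - A)) \<le> (card (mixed_cells \<eta> N A) + card (mixed_cells \<eta> N B)) * \<eta>"
proof -
  define M where "M = mixed_cells \<eta> N A \<union> mixed_cells \<eta> N B"
  have fin: "finite M" by (simp add: M_def mixed_cells_def)
  have sub: "(A - B) \<union> (B - A) \<subseteq> (\<Union>i\<in>M. {real i*\<eta>..real (Suc i)*\<eta>})"
  proof
    fix x assume x: "x \<in> (A - B) \<union> (B - A)"
    then have "0 \<le> x" "x \<le> real N*\<eta>" using assms by auto
    \<comment> \<open>The right end is itself a grid point, where the sets agree; hence the cell
      index below is less than \<open>N\<close>.\<close>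
    have "x \<noteq> real N*\<eta>" using x agree[of N] by auto
    define i where "i = nat \<lfloor>x/\<eta>\<rfloor>"
    have fl: "real i = real_of_int \<lfloor>x/\<eta>\<rfloor>" using \<open>0 \<le> x\<close> assms(1) by (simp add: i_def)
    then have "i \<le> x/\<eta>" "x/\<eta> < i + 1" by linarith+
    then have i: "real i*\<eta> \<le> x" "x < (i+1)*\<eta>" using assms(1) by (auto simp: field_simps)
    then have "real i*\<eta> < real N*\<eta>" using \<open>x \<le> real N*\<eta>\<close> \<open>x \<noteq> real N*\<eta>\<close> by linarith
    then have "i < N" using assms(1) by (simp add: mult_less_cancel_right)
    have cell: "x \<in> {real i*\<eta>..real (Suc i)*\<eta>}" "real i*\<eta> \<in> {real i*\<eta>..real (Suc i)*\<eta>}"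
      using i assms(1) by (auto simp: algebra_simps)
    have "i \<in> M"
      using x agree[of i] \<open>i < N\<close> cell unfolding M_def mixed_cells_def by auto
    then show "x \<in> (\<Union>i\<in>M. {real i*\<eta>..real (Suc i)*\<eta>})" using cell by auto
  qed
  then have "measure lborel ((A - B) \<union> (B - A)) \<le> measure lborel (\<Union>i\<in>M. {real i*\<eta>..real (Suc i)*\<eta>})"
  \<comment> \<open>On a non-measurable set \<open>measure\<close> takes the value 0, so the bound
    is trivial there.\<close>
  proof (cases "(A - B) \<union> (B - A) \<in> sets lborel")
    case True
    with sub show ?thesis
      by (intro measure_mono_fmeasurable fmeasurable.finite_UN fin)
        (auto simp: fmeasurable_def emeasure_lborel_Icc_eq)
  qed (simp add: measure_notin_sets)
  also have "\<dots> \<le> (\<Sum>i\<in>M. measure lborel {real i*\<eta>..real (Suc i)*\<eta>})"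
    using fin by (intro measure_UNION_le) auto
  also have "\<dots> = card M * \<eta>"
    using assms(1) by (simp add: algebra_simps)
  also have "\<dots> \<le> (card (mixed_cells \<eta> N A) + card (mixed_cells \<eta> N B)) * \<eta>"
    using card_Un_le[of "mixed_cells \<eta> N A" "mixed_cells \<eta> N B"] assms(1)
    by (intro mult_right_mono) (auto simp: M_def simp flip: of_nat_add)
  finally show ?thesis .
qed

lemma card_mixed_cells_connected:
  assumes "connected_piece E len X" "X \<subseteq> cake_points V E len" "\<eta> > 0"
  shows "card (mixed_cells \<eta> N {t. EPt e t \<in> X}) \<le> 4"
proof -
  obtain I J where IJ: "is_interval I" "is_interval J" "{t. EPt e t \<in> X} = I \<union> (J :: real set)"
    using connected_piece_two_intervals[OF assms(1,2)] by blast
  show ?thesis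
    using card_mixed_cells_Un[of \<eta> N I J] card_mixed_cells_interval[OF IJ(1) assms(3), of N]
      card_mixed_cells_interval[OF IJ(2) assms(3), of N] unfolding IJ(3) by linarith
qed

lemma cake_is_piece: "is_piece V E len (cake_points V E len)"
  unfolding is_piece_def
proof (intro conjI ballI)
  fix e assume "e \<in> E"
  then have "{t. EPt e t \<in> cake_points V E len} = {0<..<len e}"
    by (cases e) (auto simp: cake_points_def)
  then show "\<exists>F. finite F \<and> (\<forall>I\<in>F. is_interval (I :: real set)) \<and> {t. EPt e t \<in> cake_points V E len} = \<Union>F"
    by (intro exI[of _ "{{0<..<len e}}"]) (auto simp: is_interval_1)
qed auto

lemma sym_diff_points:
  "{t. EPt e t \<in> (X - Y) \<union> (Y - X)} =
    ({t. EPt e t \<in> X} - {t. EPt e t \<in> Y}) \<union> ({t. EPt e t \<in> Y} - {t. EPt e t \<in> X})"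
  by auto

text \<open>The constant 8 is 4 for each of the two pieces: two intervals per edge, two mixed cells
  per interval. It does not depend on the pieces, so a fixed grid works for a whole sequence of
  them.\<close>

lemma piece_len_sym_diff_le:
  assumes "finite E" "\<And>e. e \<in> E \<Longrightarrow> len e > 0" "K > 0"
    and X: "connected_piece E len X" "X \<subseteq> cake_points V E len"
    and Y: "connected_piece E len Y" "Y \<subseteq> cake_points V E len"
    and agree: "\<And>e i. e \<in> E \<Longrightarrow> i \<le> K \<Longrightarrow> EPt e (real i * (len e / real K)) \<in> X \<longleftrightarrow> EPt e (real i * (len e / real K)) \<in> Y"
  shows "piece_len E ((X - Y) \<union> (Y - X)) \<le> 8 * (\<Sum>e\<in>E. len e) / real K"
proof -
  have "measure lborel {t. EPt e t \<in> (X - Y) \<union> (Y - X)} \<le> 8 * (len e / real K)" if e: "e \<in> E" for e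
  proof -
    define \<eta> where "\<eta> = len e / real K"
    have \<eta>: "\<eta> > 0" "real K * \<eta> = len e" using assms(2)[OF e] assms(3) by (auto simp: \<eta>_def)
    have "{t. EPt e t \<in> X} \<subseteq> {0..real K * \<eta>}" "{t. EPt e t \<in> Y} \<subseteq> {0..real K * \<eta>}"
      using X(2) Y(2) unfolding \<eta> by (auto simp: cake_points_def)
    then have "measure lborel {t. EPt e t \<in> (X - Y) \<union> (Y - X)} \<le>
        (card (mixed_cells \<eta> K {t. EPt e t \<in> X}) + card (mixed_cells \<eta> K {t. EPt e t \<in> Y})) * \<eta>"
      unfolding sym_diff_points using agree[OF e] \<eta>(1)
      by (intro measure_sym_diff_le) (auto simp: \<eta>_def)
    also have "\<dots> \<le> 8 * \<eta>"
      using card_mixed_cells_connected[OF X \<eta>(1), of K e] card_mixed_cells_connected[OF Y \<eta>(1), of K e] \<eta>(1)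
      by (intro mult_right_mono) auto
    finally show ?thesis by (simp add: \<eta>_def)
  qed
  then have "piece_len E ((X - Y) \<union> (Y - X)) \<le> (\<Sum>e\<in>E. 8 * (len e / real K))"
    unfolding piece_len_def by (intro sum_mono) auto
  then show ?thesis by (simp add: sum_distrib_left sum_divide_distrib)
qed

text \<open>If one of the finitely many grid segments leaves \<open>Q\<close>, a single point
  outside \<open>Q\<close> witnesses it (chosen by \<open>g\<close>). A \<open>P m\<close> that
  agrees with \<open>Q\<close> at all these witnesses can use only segments that lie inside
  \<open>Q\<close>.\<close>

lemma connected_cluster:
  assumes "finite E"
    and conn: "\<And>m. connected_piece E len (P m)"
    and agree: "\<And>F. finite F \<Longrightarrow> \<exists>m. \<forall>x\<in>F. x \<in> P m \<longleftrightarrow> x \<in> Q"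
  shows "connected_piece E len Q"
  unfolding connected_piece_def
proof (intro ballI)
  fix x y assume xy: "x \<in> Q" "y \<in> Q"
  define \<Gamma> where "\<Gamma> e = {0, len e} \<union> {t. EPt e t \<in> {x, y}}" for e
  have fin\<Gamma>: "finite (\<Gamma> e)" for e
  proof -
    have "inj (EPt e)" by (auto intro: injI)
    then have "finite (EPt e -` {x, y})" by (intro finite_vimageI) auto
    then show ?thesis by (simp add: \<Gamma>_def vimage_def)
  qed
  define bad where "bad e t t' z \<longleftrightarrow> z \<notin> Q \<and> (\<exists>u\<in>closed_segment t t'. edge_pt len e u = z)" for e t t' z
  define T where "T = Sigma E (\<lambda>e. \<Gamma> e \<times> \<Gamma> e)"
  define g where "g = (\<lambda>(e, t, t'). SOME z. bad e t t' z)"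
  have "finite T" unfolding T_def using assms(1) fin\<Gamma> by blast
  then have "finite ({x, y} \<union> g ` T)" by simp
  from agree[OF this] obtain m where m: "\<forall>z\<in>{x, y} \<union> g ` T. z \<in> P m \<longleftrightarrow> z \<in> Q" by blast
  define G where "G = {(edge_pt len e t, edge_pt len e t') | e t t'.
    e \<in> E \<and> t \<in> \<Gamma> e \<and> t' \<in> \<Gamma> e \<and> seg_in len (P m) e t t'}"
  have "(x, y) \<in> (path_step E len (P m))\<^sup>*" using conn[of m] m xy by (auto simp: connected_piece_def)
  then have "(x, y) \<in> G\<^sup>*" unfolding G_def by (rule grid_path) (auto simp: \<Gamma>_def)
  moreover have "G \<subseteq> path_step E len Q"
  proof -
    have "seg_in len Q e t t'" if et: "e \<in> E" "t \<in> \<Gamma> e" "t' \<in> \<Gamma> e" "seg_in len (P m) e t t'" for e t t'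
    proof (rule ccontr)
      assume "\<not> ?thesis"
      then have "\<exists>z. bad e t t' z" using et(4) by (auto simp: seg_in_def bad_def)
      then have "bad e t t' (g (e, t, t'))" unfolding g_def by (simp add: someI_ex)
      moreover have "g (e, t, t') \<in> P m \<longleftrightarrow> g (e, t, t') \<in> Q" using m et by (auto simp: T_def)
      ultimately show False using et(4) by (auto simp: bad_def seg_in_def)
    qed
    then show ?thesis unfolding G_def path_step_def by blast
  qed
  ultimately show "(x, y) \<in> (path_step E len Q)\<^sup>*" using rtrancl_mono by blast
qed

section \<open>Distances\<close>

lemma walk_nonneg: "walk E len a b L \<Longrightarrow> \<forall>e\<in>E. len e \<ge> 0 \<Longrightarrow> L \<ge> 0"
  by (induction rule: walk.induct) auto

text \<open>This is how the lower bound on edge lengths enters: a walk with at least one edge is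
  already as long as \<open>s\<close>.\<close>

lemma walk_short:
  "walk E len a b L \<Longrightarrow> \<forall>e\<in>E. len e \<ge> s \<Longrightarrow> L < s \<Longrightarrow> s > 0 \<Longrightarrow> a = b"
proof (induction rule: walk.induct)
  case (walk_fwd a b c L)
  then show ?case using walk_nonneg[OF walk_fwd(2)] by force
next
  case (walk_bwd b a c L)
  then show ?case using walk_nonneg[OF walk_bwd(2)] by force
qed auto

lemma walk_snoc:
  "walk E len a b L \<Longrightarrow> (b, c) \<in> E \<Longrightarrow> walk E len a c (L + len (b, c))"
  "walk E len a b L \<Longrightarrow> (c, b) \<in> E \<Longrightarrow> walk E len a c (L + len (c, b))"
proof (induction rule: walk.induct)
  case (walk_nil u)
  { case 1 then show ?case using walk.walk_fwd[of u c E len c 0] by (simp add: walk.walk_nil) }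
  { case 2 then show ?case using walk.walk_bwd[of c u E len c 0] by (simp add: walk.walk_nil) }
next
  case (walk_fwd x y z L)
  { case 1 then show ?case using walk.walk_fwd[OF walk_fwd(1) walk_fwd(3)] by (simp add: add.assoc) }
  { case 2 then show ?case using walk.walk_fwd[OF walk_fwd(1) walk_fwd(4)] by (simp add: add.assoc) }
next
  case (walk_bwd x y z L)
  { case 1 then show ?case using walk.walk_bwd[OF walk_bwd(1) walk_bwd(3)] by (simp add: add.assoc) }
  { case 2 then show ?case using walk.walk_bwd[OF walk_bwd(1) walk_bwd(4)] by (simp add: add.assoc) }
qed

text \<open>Distance bounds are kept as existential statements about real numbers, so that moves can
  be chained without infima or \<open>ennreal\<close> arithmetic.\<close>

definition vertex_within where
  "vertex_within E len x v K \<longleftrightarrow> (\<exists>a \<alpha> M. (a, \<alpha>) \<in> anchors len x \<and> walk E len a v M \<and> \<alpha> + M \<le> K)"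

lemma vertex_within_mono: "vertex_within E len x v K \<Longrightarrow> K \<le> K' \<Longrightarrow> vertex_within E len x v K'"
  by (fastforce simp: vertex_within_def)

lemma vertex_within_edge:
  assumes "e \<in> E"
  shows "vertex_within E len x (fst e) K \<Longrightarrow> vertex_within E len x (snd e) (K + len e)"
    "vertex_within E len x (snd e) K \<Longrightarrow> vertex_within E len x (fst e) (K + len e)"
proof -
  have e: "(fst e, snd e) \<in> E" using assms by simp
  assume "vertex_within E len x (fst e) K"
  then obtain a \<alpha> M where *: "(a, \<alpha>) \<in> anchors len x" "walk E len a (fst e) M" "\<alpha> + M \<le> K"
    by (auto simp: vertex_within_def)
  have "walk E len a (snd e) (M + len e)" using walk_snoc(1)[OF *(2) e] by simp
  then show "vertex_within E len x (snd e) (K + len e)"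
    using * unfolding vertex_within_def by (intro exI[of _ a] exI[of _ \<alpha>] exI[of _ "M + len e"]) auto
next
  have e: "(fst e, snd e) \<in> E" using assms by simp
  assume "vertex_within E len x (snd e) K"
  then obtain a \<alpha> M where *: "(a, \<alpha>) \<in> anchors len x" "walk E len a (snd e) M" "\<alpha> + M \<le> K"
    by (auto simp: vertex_within_def)
  have "walk E len a (fst e) (M + len e)" using walk_snoc(2)[OF *(2) e] by simp
  then show "vertex_within E len x (fst e) (K + len e)"
    using * unfolding vertex_within_def by (intro exI[of _ a] exI[of _ \<alpha>] exI[of _ "M + len e"]) auto
qed

text \<open>Unlike \<open>dist_le\<close> below, this treats the end points of an edge like its interior points,
  so that moving along the edge needs no case distinction.\<close>
definition edge_within where
  "edge_within E len x e t L \<longleftrightarrow> (\<exists>u. x = EPt e u \<and> 0 < u \<and> u < len e \<and> \<bar>u - t\<bar> \<le> L) \<or>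
     vertex_within E len x (fst e) (L - t) \<or> vertex_within E len x (snd e) (L - (len e - t))"

definition dist_le where
  "dist_le E len x y L \<longleftrightarrow> (\<exists>e u t. x = EPt e u \<and> y = EPt e t \<and> \<bar>u - t\<bar> \<le> L) \<or>
     (\<exists>b \<beta>. (b, \<beta>) \<in> anchors len y \<and> vertex_within E len x b (L - \<beta>))"

lemma vertex_within_self:
  "x = EPt e u \<Longrightarrow> vertex_within E len x (fst e) u" "x = EPt e u \<Longrightarrow> vertex_within E len x (snd e) (len e - u)"
  unfolding vertex_within_def by (force intro: walk.walk_nil)+

text \<open>At an end of the edge one disjunct absorbs the others: arriving there across the edge
  means prolonging a walk by that edge, or walking from \<open>x\<close> to one of its own
  anchors.\<close>

lemma dist_le_iff_edge_within:
  assumes "e \<in> E" "t \<in> {0..len e}" "len e > 0" "x \<in> cake_points V E len"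
  shows "dist_le E len x (edge_pt len e t) L \<longleftrightarrow> edge_within E len x e t L"
proof -
  consider "t = 0" | "t = len e" | "0 < t" "t < len e" using assms(2) by fastforce
  then show ?thesis
  proof cases
    case 1
    have "vertex_within E len x (fst e) L" if "x = EPt e u" "0 < u" "\<bar>u - t\<bar> \<le> L" for u
      using vertex_within_mono[OF vertex_within_self(1)[OF that(1)]] that 1 by auto
    moreover have "vertex_within E len x (fst e) L" if "vertex_within E len x (snd e) (L - (len e - t))"
      using vertex_within_edge(2)[OF assms(1) that] 1 by simp
    ultimately show ?thesis using 1 by (auto simp: edge_pt_def dist_le_def edge_within_def)
  next
    case 2
    have "vertex_within E len x (snd e) L" if "x = EPt e u" "u < len e" "\<bar>u - t\<bar> \<le> L" for u
      using vertex_within_mono[OF vertex_within_self(2)[OF that(1)]] that 2 by auto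
    moreover have "vertex_within E len x (snd e) L" if "vertex_within E len x (fst e) (L - t)"
      using vertex_within_edge(1)[OF assms(1) that] 2 by simp
    ultimately show ?thesis using 2 assms(3) by (auto simp: edge_pt_def dist_le_def edge_within_def)
  next
    case 3
    then show ?thesis using assms(4)
      by (auto simp: edge_pt_def dist_le_def edge_within_def cake_points_def)
  qed
qed

lemma dist_le_step:
  assumes "e \<in> E" "t \<in> {0..len e}" "t' \<in> {0..len e}" "len e > 0" "x \<in> cake_points V E len"
    and "dist_le E len x (edge_pt len e t) L"
  shows "dist_le E len x (edge_pt len e t') (L + \<bar>t - t'\<bar>)"
proof -
  have "edge_within E len x e t L" using assms dist_le_iff_edge_within by metis
  then have "edge_within E len x e t' (L + \<bar>t - t'\<bar>)"
    unfolding edge_within_def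
    by (elim disjE) (auto intro: vertex_within_mono)
  then show ?thesis using assms dist_le_iff_edge_within by metis
qed

lemma anchors_nonneg: "x \<in> cake_points V E len \<Longrightarrow> (a, \<alpha>) \<in> anchors len x \<Longrightarrow> 0 \<le> \<alpha>"
  by (auto simp: cake_points_def)

lemma pdist_le_of_dist_le:
  assumes "x \<in> cake_points V E len" "y \<in> cake_points V E len" "\<forall>e\<in>E. len e \<ge> 0" "dist_le E len x y L"
  shows "pdist E len x y \<le> ennreal L"
  using assms(4) unfolding dist_le_def
proof (elim disjE exE conjE)
  fix e u t assume "x = EPt e u" "y = EPt e t" "\<bar>u - t\<bar> \<le> L"
  then have "direct_dist x y \<le> ennreal L" by (auto intro: ennreal_leI)
  then show ?thesis unfolding pdist_def by (rule min.coboundedI1)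
next
  fix b \<beta> assume b: "(b, \<beta>) \<in> anchors len y" "vertex_within E len x b (L - \<beta>)"
  then obtain a \<alpha> M where a: "(a, \<alpha>) \<in> anchors len x" "walk E len a b M" "\<alpha> + M \<le> L - \<beta>"
    by (auto simp: vertex_within_def)
  have nn: "0 \<le> \<alpha>" "0 \<le> \<beta>" "0 \<le> M" using anchors_nonneg assms a b walk_nonneg by metis+
  have "vdist E len a b \<le> ennreal M" unfolding vdist_def using a by (intro Inf_lower) auto
  then have "ennreal \<alpha> + vdist E len a b + ennreal \<beta> \<le> ennreal \<alpha> + ennreal M + ennreal \<beta>"
    by (intro add_mono) auto
  also have "\<dots> = ennreal (\<alpha> + M + \<beta>)" using nn by simp
  also have "\<dots> \<le> ennreal L" using a by (intro ennreal_leI) auto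
  finally show ?thesis unfolding pdist_def
    using a b by (intro min.coboundedI2 INF_lower2[OF a(1)] INF_lower2[OF b(1)]) auto
qed

text \<open>Walks between distinct vertices have length at least \<open>s\<close>, so a connection
  shorter than \<open>s\<close> runs inside one edge or through a single vertex. This locality is
  what makes distances in the graph comparable with those in the forest.\<close>

lemma pdist_less_cases:
  assumes "pdist E len x y < ennreal s" "\<forall>e\<in>E. len e \<ge> s" "s > 0"
    "x \<in> cake_points V E len" "y \<in> cake_points V E len"
  shows "(\<exists>e t t'. x = EPt e t \<and> y = EPt e t' \<and> \<bar>t - t'\<bar> < s) \<or>
    (\<exists>a \<alpha> \<beta>. (a, \<alpha>) \<in> anchors len x \<and> (a, \<beta>) \<in> anchors len y \<and> \<alpha> + \<beta> < s)"
proof -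
  consider "direct_dist x y < ennreal s" | a \<alpha> b \<beta> where "(a, \<alpha>) \<in> anchors len x" "(b, \<beta>) \<in> anchors len y"
    "ennreal \<alpha> + vdist E len a b + ennreal \<beta> < ennreal s"
    using assms(1) unfolding pdist_def min_less_iff_disj INF_less_iff by auto
  then show ?thesis
  proof cases
    case 1
    then show ?thesis
      by (cases x; cases y) (auto simp: ennreal_less_iff split: if_splits)
  next
    case 2
    have nn: "0 \<le> \<alpha>" "0 \<le> \<beta>" using anchors_nonneg assms 2 by metis+
    have "vdist E len a b \<le> ennreal \<alpha> + vdist E len a b + ennreal \<beta>"
      by (metis add.commute add_increasing2 le_iff_add zero_le)
    then have "vdist E len a b < ennreal s" using 2 by (metis order_le_less_trans)
    then obtain L where L: "walk E len a b L" "ennreal L < ennreal s"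
      unfolding vdist_def Inf_less_iff by auto
    have "L < s" using L(2) assms(3) by (metis ennreal_leI not_le)
    then have "a = b" using walk_short[OF L(1)] assms by auto
    have "ennreal (\<alpha> + \<beta>) \<le> ennreal \<alpha> + vdist E len a b + ennreal \<beta>"
      using nn by (simp add: add_right_mono)
    then have "ennreal (\<alpha> + \<beta>) < ennreal s" using 2 by (metis order_le_less_trans)
    then have "\<alpha> + \<beta> < s" by (metis ennreal_leI not_le)
    then show ?thesis using 2 \<open>a = b\<close> by blast
  qed
qed

lemma dist_le_refl: "dist_le E len x x 0"
proof (cases x)
  case (Vtx u)
  then show ?thesis unfolding dist_le_def vertex_within_def by (auto intro!: exI[of _ 0] walk.walk_nil)
qed (auto simp: dist_le_def)

text \<open>Separation as a condition on pairs of points, the form that passes to pointwise limits.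
  A common point of two pieces would be at distance 0 from itself, which is below
  \<open>s\<close>.\<close>

lemma sep_family_iff:
  assumes "s > 0" "\<forall>e\<in>E. len e \<ge> 0"
  shows "sep_family V E len s k P \<longleftrightarrow>
    (\<forall>j<k. is_piece V E len (P j) \<and> connected_piece E len (P j)) \<and>
    (\<forall>i<k. \<forall>j<k. i \<noteq> j \<longrightarrow> (\<forall>x\<in>P i. \<forall>y\<in>P j. ennreal s \<le> pdist E len x y))" (is "?L \<longleftrightarrow> ?R")
proof
  assume ?L
  then show ?R unfolding sep_family_def Dist_def le_INF_iff by blast
next
  assume R: ?R
  have "P i \<inter> P j = {}" if "i < k" "j < k" "i \<noteq> j" for i j
  proof (rule ccontr)
    assume "P i \<inter> P j \<noteq> {}"
    then obtain x where x: "x \<in> P i" "x \<in> P j" by blast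
    then have "x \<in> cake_points V E len" using R that by (auto simp: is_piece_def)
    then have "pdist E len x x \<le> ennreal 0"
      using assms by (intro pdist_le_of_dist_le dist_le_refl)
    moreover have "ennreal s \<le> pdist E len x x" using R that x by blast
    ultimately have "ennreal s \<le> 0" by simp
    then show False using assms by (simp add: ennreal_eq_0_iff)
  qed
  then show ?L using R unfolding sep_family_def Dist_def le_INF_iff by blast
qed

section \<open>Attaining the maximin share\<close>

lemma finite_edges: "metric_graph V E len \<Longrightarrow> finite E"
  by (auto simp: metric_graph_def intro: finite_subset[of E "V \<times> V"])

lemma MMS_attained:
  assumes graph: "metric_graph V E len" and s: "s > 0" and val: "valuation V E len v" and k: "k \<ge> 1"
  obtains P where "sep_family V E len s k P" "\<And>j. j < k \<Longrightarrow> MMS V E len v k s \<le> v (P j)"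
proof -
  have len_pos: "\<And>e. e \<in> E \<Longrightarrow> len e > 0" using graph by (auto simp: metric_graph_def)
  then have iff: "sep_family V E len s k P \<longleftrightarrow>
    (\<forall>j<k. is_piece V E len (P j) \<and> connected_piece E len (P j)) \<and>
    (\<forall>i<k. \<forall>j<k. i \<noteq> j \<longrightarrow> (\<forall>x\<in>P i. \<forall>y\<in>P j. ennreal s \<le> pdist E len x y))" for P
    by (intro sep_family_iff s) (auto intro: less_imp_le)
  define M where "M = MMS V E len v k s"
  define A where "A = {Min ((\<lambda>j. v (P j)) ` {..<k}) | P. sep_family V E len s k P}"
  have M: "M = Sup A" by (simp add: M_def MMS_def A_def)
  \<comment> \<open>Empty pieces are connected and vacuously separated, so the supremum ranges over
    a nonempty set.\<close>
  have "sep_family V E len s k (\<lambda>_. {})"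
    unfolding iff by (auto simp: connected_piece_def is_piece_def)
  then have "A \<noteq> {}" by (auto simp: A_def)
  have bdd: "bdd_above A"
  proof (rule bdd_aboveI)
    fix a assume "a \<in> A"
    then obtain P where P: "sep_family V E len s k P" "a = Min ((\<lambda>j. v (P j)) ` {..<k})" by (auto simp: A_def)
    then have "a \<le> v (P 0)" using k by auto
    also have "\<dots> \<le> v (cake_points V E len)"
      using val P(1) k cake_is_piece[of V E len] unfolding valuation_def iff by (auto simp: is_piece_def)
    finally show "a \<le> v (cake_points V E len)" .
  qed
  have "\<exists>P. sep_family V E len s k P \<and> (\<forall>j<k. M - 1 / real (Suc m) < v (P j))" for m
  proof -
    have "M - 1 / real (Suc m) < Sup A" by (simp add: M)
    then obtain a where "a \<in> A" "M - 1 / real (Suc m) < a" using less_cSupD[OF \<open>A \<noteq> {}\<close>] by blast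
    then obtain P where P: "sep_family V E len s k P" "M - 1 / real (Suc m) < Min ((\<lambda>j. v (P j)) ` {..<k})"
      by (auto simp: A_def)
    have "Min ((\<lambda>j. v (P j)) ` {..<k}) \<le> v (P j)" if "j < k" for j using that by auto
    then show ?thesis using P by (meson less_le_trans)
  qed
  then obtain P where P: "\<And>m. sep_family V E len s k (P m)" "\<And>m j. j < k \<Longrightarrow> M - 1 / real (Suc m) < v (P m j)"
    by metis
  \<comment> \<open>One cluster point for all pieces together: the same \<open>m\<close> can then
    serve two different pieces, as separation requires.\<close>
  obtain \<tau> where \<tau>: "\<And>F N. finite F \<Longrightarrow> \<exists>m\<ge>N. \<forall>jx\<in>F. (case jx of (j, x) \<Rightarrow> x \<in> P m j) = \<tau> jx"
    using cluster_point[of "\<lambda>m (j, x). x \<in> P m j"] by blast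
  define Q where "Q j = {x. \<tau> (j, x)}" for j
  have agree: "\<exists>m\<ge>N. \<forall>(j, x)\<in>F. x \<in> P m j \<longleftrightarrow> x \<in> Q j" if "finite F" for F N
    using \<tau>[OF that, of N] by (auto simp: Q_def split_beta)
  have agree1: "\<exists>m\<ge>N. \<forall>x\<in>F. x \<in> P m j \<longleftrightarrow> x \<in> Q j" if "finite F" for F N j
    using agree[of "Pair j ` F" N] that by auto
  have Pconn: "connected_piece E len (P m j)" "P m j \<subseteq> cake_points V E len" "is_piece V E len (P m j)" if "j < k" for m j
    using P(1)[of m] that unfolding iff by (auto simp: is_piece_def)
  have Qsub: "Q j \<subseteq> cake_points V E len" if "j < k" for j
  proof
    fix x assume "x \<in> Q j"
    then obtain m where "x \<in> P m j" using agree1[of "{x}" 0 j] by auto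
    then show "x \<in> cake_points V E len" using Pconn(2)[OF that] by blast
  qed
  have fin: "finite E" using graph by (rule finite_edges)
  have Qconn: "connected_piece E len (Q j)" if "j < k" for j
    using agree1[of _ 0 j] by (intro connected_cluster[where P = "\<lambda>m. P m j", OF fin Pconn(1)[OF that]]) blast
  have Qpiece: "is_piece V E len (Q j)" if "j < k" for j
    using connected_is_piece[OF Qconn Qsub] that by blast
  have "ennreal s \<le> pdist E len x y" if ij: "i < k" "j < k" "i \<noteq> j" "x \<in> Q i" "y \<in> Q j" for i j x y
  proof -
    obtain m where "x \<in> P m i" "y \<in> P m j" using agree[of "{(i, x), (j, y)}" 0] ij by auto
    then show ?thesis using P(1)[of m] ij unfolding iff by blast
  qed
  then have "sep_family V E len s k Q" unfolding iff using Qconn Qpiece by blast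
  moreover have "M \<le> v (Q j)" if j: "j < k" for j
  proof (rule field_le_epsilon)
    fix \<epsilon> :: real assume "\<epsilon> > 0"
    then have "\<epsilon>/2 > 0" by simp
    then obtain \<delta> where \<delta>: "\<delta> > 0" "\<And>Y. is_piece V E len Y \<Longrightarrow>
        piece_len E ((Q j - Y) \<union> (Y - Q j)) < \<delta> \<Longrightarrow> \<bar>v (Q j) - v Y\<bar> < \<epsilon>/2"
      using val Qpiece[OF j] unfolding valuation_def by meson
    \<comment> \<open>\<open>K\<close> brings the grid bound below \<delta>, and \<open>N\<close>
      brings the gap to the supremum below \<epsilon>/2; \<open>m\<close> is then taken beyond
      \<open>N\<close> and in agreement with the limit on the grid.\<close>
    obtain K :: nat where K: "8 * (\<Sum>e\<in>E. len e) / \<delta> < real K" using reals_Archimedean2 by blast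
    have "0 \<le> (\<Sum>e\<in>E. len e)" using len_pos by (intro sum_nonneg less_imp_le)
    then have "0 \<le> 8 * (\<Sum>e\<in>E. len e) / \<delta>" using \<delta>(1) by (intro divide_nonneg_pos) auto
    then have "K > 0" using K by (simp add: gr0I order.strict_trans1)
    obtain N where N: "1 / real (Suc N) < \<epsilon>/2" using nat_approx_posE[OF \<open>\<epsilon>/2 > 0\<close>] by metis
    define F where "F = (\<lambda>(e, i). EPt e (real i * (len e / real K))) ` (E \<times> {..K})"
    have "finite F" using fin by (simp add: F_def)
    then obtain m where m: "m \<ge> N" "\<forall>x\<in>F. x \<in> P m j \<longleftrightarrow> x \<in> Q j" using agree1 by blast
    have "piece_len E ((Q j - P m j) \<union> (P m j - Q j)) \<le> 8 * (\<Sum>e\<in>E. len e) / real K"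
      using m(2) len_pos by (intro piece_len_sym_diff_le[OF fin _ \<open>K > 0\<close> Qconn[OF j] Qsub[OF j] Pconn(1,2)[OF j]])
        (auto simp: F_def)
    also have "\<dots> < \<delta>" using K \<delta>(1) \<open>K > 0\<close> by (simp add: field_simps)
    finally have "\<bar>v (Q j) - v (P m j)\<bar> < \<epsilon>/2" using \<delta>(2) Pconn(3)[OF j] by blast
    moreover have "1 / real (Suc m) \<le> 1 / real (Suc N)" using m(1) by (simp add: frac_le)
    ultimately show "M \<le> v (Q j) + \<epsilon>" using P(2)[OF j, of m] N by linarith
  qed
  ultimately show ?thesis using that unfolding M_def by blast
qed

section \<open>Rooting a forest\<close>

lemma adj_sym: "adj E u w \<Longrightarrow> adj E w u"
  by (auto simp: adj_def)

text \<open>The start of a longest path is a leaf: a neighbour off the path would extend it, and one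
  at position 2 or later would close a cycle, which leaves only position 1.\<close>

lemma acyclic_has_leaf:
  assumes "finite W" "W \<noteq> {}" "\<not> (\<exists>cs. is_cycle E W cs)" "\<And>a. (a, a) \<notin> E"
  obtains w where "w \<in> W" "\<And>x y. x \<in> W \<Longrightarrow> y \<in> W \<Longrightarrow> adj E w x \<Longrightarrow> adj E w y \<Longrightarrow> x = y"
proof -
  define path where "path cs \<longleftrightarrow> cs \<noteq> [] \<and> distinct cs \<and> set cs \<subseteq> W \<and>
    (\<forall>i. Suc i < length cs \<longrightarrow> adj E (cs ! i) (cs ! Suc i))" for cs
  have bound: "length cs < Suc (card W)" if "path cs" for cs
    using that assms(1) card_mono[of W "set cs"] by (auto simp: path_def distinct_card less_Suc_eq_le)
  obtain w0 where "w0 \<in> W" using assms(2) by auto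
  then have "path [w0]" by (auto simp: path_def)
  then obtain cs where cs: "path cs" "\<And>ds. path ds \<Longrightarrow> length ds \<le> length cs"
    using ex_has_greatest_nat[of path "[w0]" length "Suc (card W)"] bound by blast
  have on_path: "\<exists>k<length cs. k \<ge> 1 \<and> cs ! k = x" if x: "x \<in> W" "adj E (cs ! 0) x" for x
  proof (cases "x \<in> set cs")
    case True
    then obtain k where k: "k < length cs" "cs ! k = x" by (auto simp: in_set_conv_nth)
    moreover have "k \<noteq> 0"
    proof
      assume "k = 0"
      then show False using k x(2) assms(4)[of x] by (auto simp: adj_def)
    qed
    ultimately show ?thesis by auto
  next
    case False
    have "path (x # cs)"
      using cs(1) False x by (auto simp: path_def nth_Cons adj_sym split: nat.splits)
    then show ?thesis using cs(2) by fastforce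
  qed
  show ?thesis
  proof (rule that)
    show "cs ! 0 \<in> W" using cs(1) by (auto simp: path_def)
  next
    fix x y assume xy: "x \<in> W" "y \<in> W" "adj E (cs ! 0) x" "adj E (cs ! 0) y"
    have no_long: False if k: "k < length cs" "k \<ge> 2" "adj E (cs ! 0) (cs ! k)" for k
    proof -
      have "is_cycle E W (take (Suc k) cs)"
        unfolding is_cycle_def
      proof (intro conjI allI impI)
        show "distinct (take (Suc k) cs)" using cs(1) by (auto simp: path_def)
        show "3 \<le> length (take (Suc k) cs)" using k by auto
        show "set (take (Suc k) cs) \<subseteq> W"
          using cs(1) set_take_subset[of "Suc k" cs] by (auto simp: path_def)
      next
        fix i assume "i < length (take (Suc k) cs)"
        then have i: "i \<le> k" using k by auto
        show "adj E (take (Suc k) cs ! i) (take (Suc k) cs ! ((i + 1) mod length (take (Suc k) cs)))"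
        proof (cases "i = k")
          case True
          moreover have "min (length cs) (Suc k) = Suc k" using k by simp
          ultimately show ?thesis using k by (simp add: adj_sym)
        next
          case False
          then show ?thesis using k i cs(1) by (auto simp: min_def path_def)
        qed
      qed
      then show False using assms(3) by blast
    qed
    obtain k l where "k < length cs" "k \<ge> 1" "cs ! k = x" "l < length cs" "l \<ge> 1" "cs ! l = y"
      using on_path xy by metis
    then show "x = y" using no_long[of k] no_long[of l] xy
      by (metis One_nat_def Suc_1 Suc_leI le_neq_implies_less)
  qed
qed

text \<open>Edges are stored with an arbitrary direction; \<open>up e\<close> records that the first
  component is the end nearer the root.\<close>

definition upper :: "('v \<times> 'v \<Rightarrow> bool) \<Rightarrow> 'v \<times> 'v \<Rightarrow> 'v" where
  "upper up e = (if up e then fst e else snd e)"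

definition lower :: "('v \<times> 'v \<Rightarrow> bool) \<Rightarrow> 'v \<times> 'v \<Rightarrow> 'v" where
  "lower up e = (if up e then snd e else fst e)"

text \<open>Leaves are put back one at a time. The new vertex becomes the lower end of its only
  edge, so no vertex ever gets two edges leading up.\<close>

lemma forest_orientation:
  assumes "finite W" "\<not> (\<exists>cs. is_cycle E W cs)" "\<forall>(a,b)\<in>E. a \<noteq> b \<and> (b,a) \<notin> E"
  shows "\<exists>up (d :: 'v \<Rightarrow> real).
    (\<forall>e\<in>E \<inter> W \<times> W. d (lower up e) = d (upper up e) + len e) \<and>
    (\<forall>e\<in>E \<inter> W \<times> W. \<forall>e'\<in>E \<inter> W \<times> W. lower up e = lower up e' \<longrightarrow> e = e')"
  using assms(1,2)
proof (induction W rule: finite_psubset_induct)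
  case (psubset W)
  show ?case
  proof (cases "W = {}")
    case True
    then show ?thesis by auto
  next
    case False
    have irr: "(a, a) \<notin> E" for a using assms(3) by auto
    obtain w where w: "w \<in> W" "\<And>x y. x \<in> W \<Longrightarrow> y \<in> W \<Longrightarrow> adj E w x \<Longrightarrow> adj E w y \<Longrightarrow> x = y"
      using acyclic_has_leaf[OF psubset(1) False psubset(3) irr] by blast
    define W' where "W' = W - {w}"
    have "W' \<subset> W" using w by (auto simp: W'_def)
    moreover have "\<not> (\<exists>cs. is_cycle E W' cs)"
      using psubset(3) by (auto simp: W'_def is_cycle_def)
    ultimately obtain up d where
      IH: "\<And>e. e \<in> E \<inter> W' \<times> W' \<Longrightarrow> d (lower up e) = d (upper up e) + len e"
        "\<And>e e'. e \<in> E \<inter> W' \<times> W' \<Longrightarrow> e' \<in> E \<inter> W' \<times> W' \<Longrightarrow> lower up e = lower up e' \<Longrightarrow> e = e'"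
      using psubset(2)[of W'] by blast
    define inc where "inc e \<longleftrightarrow> e \<in> E \<inter> W \<times> W \<and> (fst e = w \<or> snd e = w)" for e
    define up' where "up' e = (if inc e then snd e = w else up e)" for e
    have uniq: "e = e'" if "inc e" "inc e'" for e e'
    proof -
      define other where "other e = (if fst e = w then snd e else fst e)" for e
      have "other e \<in> W" "adj E w (other e)" if "inc e" for e
        using that by (auto simp: inc_def other_def adj_def)
      then have "other e = other e'" using that w(2) by blast
      \<comment> \<open>Two edges from \<open>w\<close> to the same neighbour could differ only in
        direction, and an edge is stored in one direction only.\<close>
      moreover have "fst e \<noteq> snd e" "fst e' \<noteq> snd e'" "(snd e, fst e) \<notin> E"
        using that assms(3) by (auto simp: inc_def)
      ultimately show ?thesis
        using that by (cases e; cases e') (auto simp: inc_def other_def split: if_splits)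
    qed
    \<comment> \<open>By \<open>uniq\<close>, \<open>THE\<close> picks the only edge at
      \<open>w\<close> when there is one. An isolated \<open>w\<close> becomes a root at depth
      0.\<close>
    define d' where "d' = d(w := (if \<exists>e. inc e then
      d (upper up' (THE e. inc e)) + len (THE e. inc e) else 0))"
    have split: "inc e \<or> e \<in> E \<inter> W' \<times> W'" if "e \<in> E \<inter> W \<times> W" for e
      using that by (auto simp: inc_def W'_def)
    have inc1: "lower up' e = w" "upper up' e \<noteq> w" if "inc e" for e
      using that irr by (auto simp: lower_def upper_def up'_def inc_def)
    have old: "lower up' e = lower up e" "upper up' e = upper up e" "lower up e \<noteq> w" "upper up e \<noteq> w"
      if "e \<in> E \<inter> W' \<times> W'" for e
      using that by (auto simp: lower_def upper_def up'_def inc_def W'_def)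
    have d1: "d' (lower up' e) = d' (upper up' e) + len e" if "e \<in> E \<inter> W \<times> W" for e
      using split[OF that]
    proof
      assume e: "inc e"
      then have "(THE e. inc e) = e" using uniq by blast
      moreover have "\<exists>e. inc e" using e by blast
      ultimately show ?thesis using inc1[OF e] by (simp add: d'_def)
    next
      assume "e \<in> E \<inter> W' \<times> W'"
      then show ?thesis using IH(1) old by (auto simp: d'_def)
    qed
    have "e = e'" if "e \<in> E \<inter> W \<times> W" "e' \<in> E \<inter> W \<times> W" "lower up' e = lower up' e'" for e e'
      using split[OF that(1)] split[OF that(2)] that(3) uniq IH(2) inc1 old by metis
    with d1 show ?thesis by blast
  qed
qed

text \<open>Applied with \<open>r\<close> the upward moves inside a piece and \<open>R\<close> those in the whole forest.\<close>
lemma nested_rtrancl_comparable: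
  assumes one: "\<And>q m m'. (q, m) \<in> r \<Longrightarrow> (q, m') \<in> R \<Longrightarrow> (m, m') \<in> R \<or> (m', m) \<in> r"
    and "(q, m) \<in> r\<^sup>*" "(q, m') \<in> R\<^sup>*"
  shows "(m, m') \<in> R\<^sup>* \<or> (m', m) \<in> r\<^sup>*"
proof -
  have one_step: "(m, m') \<in> R\<^sup>* \<or> (m', m) \<in> r\<^sup>*" if "(q, m) \<in> r\<^sup>*" "(q, m') \<in> R" for q m m'
    using that
  proof (induction arbitrary: m' rule: converse_rtrancl_induct)
    case base
    then show ?case by auto
  next
    case (step q m1)
    from one[OF step(1) step(4)] show ?case
    proof
      assume "(m1, m') \<in> R"
      then show ?thesis using step(3) by blast
    next
      assume "(m', m1) \<in> r"
      then show ?thesis using step(2) by (meson converse_rtrancl_into_rtrancl)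
    qed
  qed
  from assms(3) show ?thesis
  proof (induction rule: rtrancl_induct)
    case base
    then show ?case using assms(2) by auto
  next
    case (step a b)
    from step(3) show ?case
    proof
      assume "(m, a) \<in> R\<^sup>*"
      then show ?thesis using step(2) by auto
    next
      assume "(a, m) \<in> r\<^sup>*"
      then show ?thesis using one_step[OF _ step(2)] by blast
    qed
  qed
qed

lemma Vtx_in_image [simp]: "Vtx u \<in> Vtx ` S \<longleftrightarrow> u \<in> S"
  by auto

text \<open>Uniqueness is assumed only for options whose \<open>h\<close> is no larger than that of
  \<open>p\<close>. Fixing an option with maximal \<open>h\<close> puts all the others in this
  position, and since one agent leaves as well, the counting hypothesis persists.\<close>

lemma greedy_choice:
  fixes J :: "'i \<Rightarrow> 'j set" and h :: "'i \<Rightarrow> 'j \<Rightarrow> real"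
  assumes "finite N" "\<And>i. i \<in> N \<Longrightarrow> finite (J i) \<and> card N \<le> card (J i)"
    and conf_sym: "\<And>i p j q. conf i p j q \<Longrightarrow> conf j q i p"
    and "\<And>i j p q q'. i \<in> N \<Longrightarrow> j \<in> N \<Longrightarrow> i \<noteq> j \<Longrightarrow> p \<in> J i \<Longrightarrow> q \<in> J j \<Longrightarrow> q' \<in> J j \<Longrightarrow>
      h j q \<le> h i p \<Longrightarrow> h j q' \<le> h i p \<Longrightarrow> conf i p j q \<Longrightarrow> conf i p j q' \<Longrightarrow> q = q'"
  shows "\<exists>f. (\<forall>i\<in>N. f i \<in> J i) \<and> (\<forall>i\<in>N. \<forall>j\<in>N. i \<noteq> j \<longrightarrow> \<not> conf i (f i) j (f j))"
  using assms(1,2,4)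
proof (induction N arbitrary: J rule: finite_psubset_induct)
  case (psubset N)
  show ?case
  proof (cases "N = {}")
    case True
    then show ?thesis by auto
  next
    case False
    have pos: "card N > 0" using False psubset(1) by (simp add: card_gt_0_iff)
    have "finite (Sigma N J)" using psubset(1,3) by blast
    moreover have "Sigma N J \<noteq> {}"
    proof -
      obtain i where "i \<in> N" using False by auto
      then have "card (J i) > 0" using psubset(3) pos by (meson less_le_trans)
      then show ?thesis using \<open>i \<in> N\<close> by (auto simp: card_gt_0_iff)
    qed
    ultimately obtain ip where ip: "ip \<in> Sigma N J"
      "\<And>jq. jq \<in> Sigma N J \<Longrightarrow> h (fst jq) (snd jq) \<le> h (fst ip) (snd ip)"
      using obtains_MAX[of "Sigma N J" "\<lambda>jq. h (fst jq) (snd jq)"]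
      by (metis (no_types, lifting) Max_ge finite_imageI image_eqI)
    define i p where "i = fst ip" and "p = snd ip"
    have i: "i \<in> N" "p \<in> J i" and max: "\<And>j q. j \<in> N \<Longrightarrow> q \<in> J j \<Longrightarrow> h j q \<le> h i p"
      using ip by (force simp: i_def p_def)+
    define J' where "J' j = {q \<in> J j. \<not> conf i p j q}" for j
    have "N - {i} \<subset> N" using i by auto
    have fin: "finite (J' j) \<and> card (N - {i}) \<le> card (J' j)" if j: "j \<in> N - {i}" for j
    proof -
      have fin: "finite (J j)" "card N \<le> card (J j)" using psubset(3) j by auto
      have "q = q'" if "q \<in> J j - J' j" "q' \<in> J j - J' j" for q q'
        using psubset(4)[of i j p q q'] that i j max by (auto simp: J'_def)
      then have "\<exists>q. J j - J' j \<subseteq> {q}" by blast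
      then obtain q where "J j - J' j \<subseteq> {q}" by auto
      then have "card (J j - {q}) \<le> card (J' j)"
        using fin by (intro card_mono) (auto simp: J'_def)
      moreover have "card (J j) - 1 \<le> card (J j - {q})"
        using fin by (simp add: card_Diff_singleton_if)
      ultimately show ?thesis using fin i psubset(1) by (auto simp: J'_def)
    qed
    have uq: "q = q'" if "i' \<in> N - {i}" "j \<in> N - {i}" "i' \<noteq> j" "p' \<in> J' i'" "q \<in> J' j" "q' \<in> J' j"
      "h j q \<le> h i' p'" "h j q' \<le> h i' p'" "conf i' p' j q" "conf i' p' j q'" for i' j p' q q'
      using psubset(4)[of i' j p' q q'] that by (auto simp: J'_def)
    have "\<exists>f. (\<forall>j\<in>N-{i}. f j \<in> J' j) \<and>
      (\<forall>j\<in>N-{i}. \<forall>k\<in>N-{i}. j \<noteq> k \<longrightarrow> \<not> conf j (f j) k (f k))"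
      by (rule psubset(2)[OF \<open>N - {i} \<subset> N\<close>]) (fact fin, rule uq)
    then obtain f where f: "\<forall>j\<in>N-{i}. f j \<in> J' j"
      "\<forall>j\<in>N-{i}. \<forall>k\<in>N-{i}. j \<noteq> k \<longrightarrow> \<not> conf j (f j) k (f k)"
      by (elim exE conjE)
    have "(f(i := p)) j \<in> J j" if "j \<in> N" for j
      using f(1) i that by (auto simp: J'_def)
    moreover have "\<not> conf j ((f(i := p)) j) k ((f(i := p)) k)" if jk: "j \<in> N" "k \<in> N" "j \<noteq> k" for j k
    proof -
      have free: "\<not> conf i p l (f l)" if "l \<in> N" "l \<noteq> i" for l
        using f(1) that by (auto simp: J'_def)
      consider "j = i" | "k = i" | "j \<in> N - {i}" "k \<in> N - {i}" using jk by blast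
      then show ?thesis
      proof cases
        case 1
        then show ?thesis using free[of k] jk by simp
      next
        case 2
        then show ?thesis using free[of j] jk conf_sym[of j "f j" i p] by auto
      next
        case 3
        then show ?thesis using f(2) jk(3) by simp
      qed
    qed
    ultimately show ?thesis by (intro exI[of _ "f(i := p)"]) simp
  qed
qed

section \<open>Separated choice in a rooted forest\<close>

text \<open>\<open>S\<close> is the set of removed vertices. By \<open>lower_depth\<close>, an edge
  that touches \<open>S\<close> has its lower end in \<open>S\<close>. By
  \<open>lower_unique\<close>, a vertex outside \<open>S\<close> has at most one edge leading
  up.\<close>

locale rooted_forest =
  fixes V :: "'v set" and E :: "('v \<times> 'v) set" and len :: "'v \<times> 'v \<Rightarrow> real" and s :: real
    and S :: "'v set" and up :: "'v \<times> 'v \<Rightarrow> bool" and dv :: "'v \<Rightarrow> real"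
  assumes graph: "metric_graph V E len"
    and s_pos: "s > 0" and len_ge: "\<forall>e\<in>E. len e \<ge> s"
    and lower_depth: "e \<in> E \<Longrightarrow> lower up e \<notin> S \<Longrightarrow> upper up e \<notin> S \<and> dv (lower up e) = dv (upper up e) + len e"
    and lower_unique: "e \<in> E \<Longrightarrow> e' \<in> E \<Longrightarrow> lower up e = lower up e' \<Longrightarrow> lower up e \<notin> S \<Longrightarrow> e = e'"
begin

abbreviation "pt \<equiv> edge_pt len"

section \<open>Heights, depths and upward moves\<close>

definition height :: "'v \<times> 'v \<Rightarrow> real \<Rightarrow> real" where
  "height e t = (if up e then t else len e - t)"

text \<open>On each component of \<open>open_cake\<close> this is the distance from its top, up to
  an additive constant. Points of different components are never \<open>near\<close> each other, so
  these constants need no relation.\<close>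

fun depth :: "'v point \<Rightarrow> real" where
  "depth (Vtx w) = dv w"
| "depth (EPt e t) = dv (upper up e) + height e t"

definition open_cake :: "'v point set" where
  "open_cake = cake_points V E len - Vtx ` S"

text \<open>The set \<open>X\<close> is a parameter so that climbing inside a piece can be compared
  with climbing in all of \<open>open_cake\<close>.\<close>

definition ups :: "'v point set \<Rightarrow> ('v point \<times> 'v point) set" where
  "ups X = {(pt e t, pt e t') | e t t'. e \<in> E \<and> seg_in len X e t t' \<and> height e t' \<le> height e t}"

lemma len_pos: "e \<in> E \<Longrightarrow> len e > 0"
  using len_ge s_pos by fastforce

lemma edge_in_V: "e \<in> E \<Longrightarrow> fst e \<in> V \<and> snd e \<in> V"
  using graph by (auto simp: metric_graph_def)

lemma upsI: "e \<in> E \<Longrightarrow> seg_in len X e t t' \<Longrightarrow> height e t' \<le> height e t \<Longrightarrow> (pt e t, pt e t') \<in> ups X"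
  unfolding ups_def by blast

lemma upsE:
  assumes "(x, y) \<in> ups X"
  obtains e t t' where "e \<in> E" "t \<in> {0..len e}" "t' \<in> {0..len e}" "seg_in len X e t t'"
    "height e t' \<le> height e t" "x = pt e t" "y = pt e t'"
  using assms unfolding ups_def seg_in_def by blast

lemma ups_in: "(x, y) \<in> ups X \<Longrightarrow> x \<in> X \<and> y \<in> X"
  by (auto simp: ups_def seg_in_def)

lemma ups_rtrancl_in: "(x, y) \<in> (ups X)\<^sup>* \<Longrightarrow> x \<in> X \<Longrightarrow> y \<in> X"
  by (induction rule: rtrancl_induct) (auto dest: ups_in)

lemma ups_rtrancl_in': "(x, y) \<in> (ups X)\<^sup>* \<Longrightarrow> y \<in> X \<Longrightarrow> x \<in> X"
  by (induction rule: converse_rtrancl_induct) (auto dest: ups_in)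

lemma ups_mono: "X \<subseteq> Y \<Longrightarrow> ups X \<subseteq> ups Y"
  unfolding ups_def seg_in_def by blast

lemma seg_in_sym: "seg_in len X e t t' \<Longrightarrow> seg_in len X e t' t"
  by (simp add: seg_in_def closed_segment_commute)

lemma path_step_ups: "path_step E len X = ups X \<union> (ups X)\<inverse>"
proof -
  have "(pt e t, pt e t') \<in> ups X \<union> (ups X)\<inverse>" if "e \<in> E" "seg_in len X e t t'" for e t t'
    using upsI[OF that] upsI[OF that(1) seg_in_sym[OF that(2)]] by (cases "height e t' \<le> height e t") auto
  then have "path_step E len X \<subseteq> ups X \<union> (ups X)\<inverse>"
    unfolding path_step_def by blast
  moreover have "ups X \<subseteq> path_step E len X"
    unfolding path_step_def ups_def by blast
  moreover have "(path_step E len X)\<inverse> \<subseteq> path_step E len X"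
    unfolding path_step_def using seg_in_sym by blast
  ultimately show ?thesis by blast
qed

lemma depth_pt:
  assumes "e \<in> E" "t \<in> {0..len e}" "pt e t \<notin> Vtx ` S"
  shows "depth (pt e t) = dv (upper up e) + height e t"
proof -
  consider "t = 0" | "t = len e" "t \<noteq> 0" | "0 < t" "t < len e" using assms(2) by fastforce
  then show ?thesis
    using assms(3) lower_depth[OF assms(1)]
    by cases (auto simp: edge_pt_def height_def upper_def lower_def split: if_splits)
qed

lemma depth_step:
  assumes "(x, y) \<in> ups open_cake"
  shows "depth y \<le> depth x"
proof -
  obtain e t t' where st: "e \<in> E" "t \<in> {0..len e}" "t' \<in> {0..len e}" "height e t' \<le> height e t" "x = pt e t" "y = pt e t'"
    using assms by (rule upsE)
  then show ?thesis using depth_pt[of e t] depth_pt[of e t'] ups_in[OF assms] by (auto simp: open_cake_def)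
qed

lemma depth_mono: "(x, y) \<in> (ups open_cake)\<^sup>* \<Longrightarrow> depth y \<le> depth x"
  by (induction rule: rtrancl_induct) (auto dest: depth_step)

text \<open>A point with two representations is a vertex, and it is the lower end of at most one
  edge. In the other representation it has height 0, where only the trivial upward move
  starts.\<close>

lemma pt_eq_cases:
  assumes "e \<in> E" "e' \<in> E" "t \<in> {0..len e}" "t' \<in> {0..len e'}" "pt e t = pt e' t'" "pt e t \<notin> Vtx ` S"
  shows "(e = e' \<and> t = t') \<or> height e t = 0 \<or> height e' t' = 0"
proof (rule ccontr)
  assume neg: "\<not> ?thesis"
  have *: "t = 0 \<or> t = len e" "t' = 0 \<or> t' = len e'"
    using neg assms by (auto simp: edge_pt_def split: if_splits)
  then have "pt e t = Vtx (lower up e)" "pt e' t' = Vtx (lower up e')"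
    using neg len_pos[OF assms(1)] len_pos[OF assms(2)]
    by (auto simp: edge_pt_def height_def lower_def split: if_splits)
  then have "lower up e = lower up e'" "lower up e \<notin> S" using assms by auto
  then have "e = e'" using lower_unique[OF assms(1,2)] by simp
  then show False using neg * by (auto simp: height_def split: if_splits)
qed

lemma height_between:
  assumes "height e b \<le> height e c" "height e c \<le> height e a"
  shows "closed_segment c b \<subseteq> closed_segment a b"
  using assms by (auto simp: height_def closed_segment_eq_real_ivl split: if_splits)

lemma height_inj: "height e a = height e b \<Longrightarrow> a = b"
  by (auto simp: height_def split: if_splits)

text \<open>Climbing involves no choice, so one of two moves from \<open>q\<close> prolongs the
  other. The second alternative is stated for the smaller set \<open>X\<close>: this is how a point
  reached by climbing in \<open>Y\<close> is later seen to lie in the piece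
  \<open>X\<close>.\<close>

lemma ups_comparable_step:
  assumes "X \<subseteq> Y" "Y \<subseteq> open_cake" "(q, m) \<in> ups X" "(q, m') \<in> ups Y"
  shows "(m, m') \<in> ups Y \<or> (m', m) \<in> ups X"
proof -
  obtain e t u where a: "e \<in> E" "t \<in> {0..len e}" "u \<in> {0..len e}" "seg_in len X e t u"
    "height e u \<le> height e t" "q = pt e t" "m = pt e u" using assms(3) by (rule upsE)
  obtain e' t' u' where b: "e' \<in> E" "t' \<in> {0..len e'}" "u' \<in> {0..len e'}" "seg_in len Y e' t' u'"
    "height e' u' \<le> height e' t'" "q = pt e' t'" "m' = pt e' u'" using assms(4) by (rule upsE)
  have nn: "height e x \<ge> 0" if "x \<in> {0..len e}" for e x using that by (auto simp: height_def)
  have "q \<notin> Vtx ` S" using ups_in[OF assms(4)] assms(2) by (auto simp: open_cake_def)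
  then consider "e = e'" "t = t'" | "height e t = 0" | "height e' t' = 0"
    using pt_eq_cases[OF a(1) b(1) a(2) b(2)] a b by auto
  then show ?thesis
  proof cases
    case 1
    show ?thesis
    proof (cases "height e u' \<le> height e u")
      case True
      then have "seg_in len Y e u u'"
        using a b 1 height_between[of e u' u t] by (auto simp: seg_in_def)
      then show ?thesis using upsI[of e Y u u'] a b 1 True by auto
    next
      case False
      then have "seg_in len X e u' u"
        using a b 1 height_between[of e u u' t] by (auto simp: seg_in_def)
      then show ?thesis using upsI[of e X u' u] a b 1 False by auto
    qed
  next
    case 2
    then have "m = q" using a nn[OF a(3)] height_inj[of e u t] by auto
    then show ?thesis using assms by auto
  next
    case 3
    then have "m' = q" using b nn[OF b(3)] height_inj[of e' u' t'] by auto
    then show ?thesis using assms by auto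
  qed
qed

lemma ups_comparable:
  assumes "X \<subseteq> Y" "Y \<subseteq> open_cake" "(q, m) \<in> (ups X)\<^sup>*" "(q, m') \<in> (ups Y)\<^sup>*"
  shows "(m, m') \<in> (ups Y)\<^sup>* \<or> (m', m) \<in> (ups X)\<^sup>*"
  by (rule nested_rtrancl_comparable[OF _ assms(3,4)]) (rule ups_comparable_step[OF assms(1,2)])

text \<open>A common ancestor is maintained along a path inside \<open>X\<close>. Downward steps
  preserve it; an upward step either stays below it or passes it, and then its end takes
  over.\<close>

lemma connected_common_ancestor:
  assumes "connected_piece E len X" "X \<subseteq> open_cake" "x \<in> X" "y \<in> X"
  obtains m where "m \<in> X" "(x, m) \<in> (ups X)\<^sup>*" "(y, m) \<in> (ups X)\<^sup>*"
proof -
  have "(x, y) \<in> (ups X \<union> (ups X)\<inverse>)\<^sup>*"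
    using assms unfolding connected_piece_def path_step_ups by blast
  then have "\<exists>m. (x, m) \<in> (ups X)\<^sup>* \<and> (y, m) \<in> (ups X)\<^sup>*"
  proof (induction rule: rtrancl_induct)
    case base
    then show ?case by blast
  next
    case (step y z)
    then obtain m where m: "(x, m) \<in> (ups X)\<^sup>*" "(y, m) \<in> (ups X)\<^sup>*" by blast
    show ?case
    proof (cases "(z, y) \<in> ups X")
      case True
      then have "(z, m) \<in> (ups X)\<^sup>*" using m by (meson converse_rtrancl_into_rtrancl)
      then show ?thesis using m by blast
    next
      case False
      then have "(y, z) \<in> (ups X)\<^sup>*" using step(2) by auto
      from ups_comparable[OF subset_refl assms(2) m(2) this] show ?thesis
      proof
        assume "(m, z) \<in> (ups X)\<^sup>*"
        then have "(x, z) \<in> (ups X)\<^sup>*" using m by simp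
        then show ?thesis by blast
      next
        assume "(z, m) \<in> (ups X)\<^sup>*"
        then show ?thesis using m by blast
      qed
    qed
  qed
  then obtain m where "(x, m) \<in> (ups X)\<^sup>*" "(y, m) \<in> (ups X)\<^sup>*" by (elim exE conjE)
  then show ?thesis using that ups_rtrancl_in[OF _ assms(3)] by simp
qed

text \<open>The left-hand side is the length of the path that climbs from \<open>p\<close> to
  \<open>m\<close> and descends to \<open>q\<close>. A higher common ancestor only lengthens it, so
  the existence of some \<open>m\<close> expresses tree distance at most \<open>L\<close>.\<close>

definition near :: "'v point \<Rightarrow> 'v point \<Rightarrow> real \<Rightarrow> bool" where
  "near p q L \<longleftrightarrow> (\<exists>m. (p, m) \<in> (ups open_cake)\<^sup>* \<and> (q, m) \<in> (ups open_cake)\<^sup>* \<and>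
     depth p + depth q - 2 * depth m \<le> L)"

lemma near_sym: "near p q L \<Longrightarrow> near q p L"
  by (auto simp: near_def algebra_simps)

lemma near_ups: "(p, q) \<in> (ups open_cake)\<^sup>* \<Longrightarrow> near p q (depth p - depth q)"
  unfolding near_def by (intro exI[of _ q]) auto

lemma near_mono: "near p q L \<Longrightarrow> L \<le> L' \<Longrightarrow> near p q L'"
  by (auto simp: near_def)

text \<open>Both turning points lie above \<open>q\<close>, hence are comparable, and the higher one
  serves for \<open>p\<close> and \<open>r\<close>.\<close>

lemma near_trans:
  assumes "near p q L" "near q r M"
  shows "near p r (L + M)"
proof -
  obtain a where a: "(p, a) \<in> (ups open_cake)\<^sup>*" "(q, a) \<in> (ups open_cake)\<^sup>*"
    "depth p + depth q - 2 * depth a \<le> L" using assms(1) by (auto simp: near_def)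
  obtain b where b: "(q, b) \<in> (ups open_cake)\<^sup>*" "(r, b) \<in> (ups open_cake)\<^sup>*"
    "depth q + depth r - 2 * depth b \<le> M" using assms(2) by (auto simp: near_def)
  have d: "depth a \<le> depth q" "depth b \<le> depth q" using a b depth_mono by auto
  from ups_comparable[OF subset_refl subset_refl a(2) b(1)] show ?thesis
  proof
    assume "(a, b) \<in> (ups open_cake)\<^sup>*"
    then have "(p, b) \<in> (ups open_cake)\<^sup>*" using a by simp
    then show ?thesis unfolding near_def using a b d by (intro exI[of _ b]) auto
  next
    assume "(b, a) \<in> (ups open_cake)\<^sup>*"
    then have "(r, a) \<in> (ups open_cake)\<^sup>*" using b by simp
    then show ?thesis unfolding near_def using a b d by (intro exI[of _ a]) auto
  qed
qed

lemma pt_in_cake: "e \<in> E \<Longrightarrow> t \<in> {0..len e} \<Longrightarrow> pt e t \<in> cake_points V E len"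
  using edge_in_V[of e] by (cases e) (auto simp: edge_pt_def cake_points_def)

lemma pt_interior_open_cake: "e \<in> E \<Longrightarrow> 0 < t \<Longrightarrow> t < len e \<Longrightarrow> pt e t \<in> open_cake"
  using pt_in_cake[of e t] by (auto simp: edge_pt_def open_cake_def)

lemma near_edge:
  assumes "e \<in> E" "seg_in len open_cake e t t'"
  shows "near (pt e t) (pt e t') \<bar>t - t'\<bar>"
proof -
  have "t \<in> {0..len e}" "t' \<in> {0..len e}" "pt e t \<in> open_cake" "pt e t' \<in> open_cake"
    using assms by (auto simp: seg_in_def)
  then have d: "depth (pt e t) = dv (upper up e) + height e t" "depth (pt e t') = dv (upper up e) + height e t'"
    using depth_pt assms(1) by (auto simp: open_cake_def)
  show ?thesis
  proof (cases "height e t' \<le> height e t")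
    case True
    then have "(pt e t, pt e t') \<in> (ups open_cake)\<^sup>*" using upsI assms by blast
    from near_ups[OF this] show ?thesis
      unfolding d by (rule near_mono) (auto simp: height_def)
  next
    case False
    then have "(pt e t', pt e t) \<in> (ups open_cake)\<^sup>*" using upsI[OF assms(1) seg_in_sym[OF assms(2)]] by auto
    from near_sym[OF near_ups[OF this]] show ?thesis
      unfolding d by (rule near_mono) (auto simp: height_def)
  qed
qed

text \<open>With \<open>a\<close> outside \<open>S\<close>, the part of the edge from
  \<open>p\<close> to \<open>a\<close> survives in \<open>open_cake\<close>, including its
  end.\<close>

lemma near_anchor:
  assumes "p \<in> open_cake" "(a, \<alpha>) \<in> anchors len p" "a \<notin> S"
  shows "near p (Vtx a) \<alpha>"
proof (cases p)
  case (Vtx u)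
  then show ?thesis using assms near_ups[of p p] by auto
next
  case (EPt e t)
  then have e: "e \<in> E" "0 < t" "t < len e" using assms(1) by (auto simp: open_cake_def cake_points_def)
  then have pt: "pt e t = p" using EPt by (simp add: edge_pt_def)
  consider "a = fst e" "\<alpha> = t" | "a = snd e" "\<alpha> = len e - t" using assms(2) EPt by auto
  then show ?thesis
  proof cases
    case 1
    have "Vtx a \<in> open_cake" using 1 assms(3) edge_in_V[OF e(1)] by (auto simp: open_cake_def cake_points_def)
    then have "pt e u \<in> open_cake" if "u \<in> {0..t}" for u
      using that pt_interior_open_cake[OF e(1), of u] 1 e by (cases "u = 0") (auto simp: edge_pt_def)
    then have "seg_in len open_cake e t 0" using e by (auto simp: seg_in_def closed_segment_eq_real_ivl)
    from near_edge[OF e(1) this] show ?thesis using pt 1 e by (simp add: edge_pt_def)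
  next
    case 2
    have "Vtx a \<in> open_cake" using 2 assms(3) edge_in_V[OF e(1)] by (auto simp: open_cake_def cake_points_def)
    then have "pt e u \<in> open_cake" if "u \<in> {t..len e}" for u
      using that pt_interior_open_cake[OF e(1), of u] 2 e by (cases "u = len e") (auto simp: edge_pt_def)
    then have "seg_in len open_cake e t (len e)" using e by (auto simp: seg_in_def closed_segment_eq_real_ivl)
    from near_edge[OF e(1) this] show ?thesis using pt 2 e by (simp add: edge_pt_def)
  qed
qed

text \<open>Two \<open>s\<close>-separated pieces never meet the same ball, and a path between points outside the balls
  that passes through \<open>S\<close> has length at least \<open>s\<close>.\<close>
definition ball_around :: "'v \<Rightarrow> 'v point set" where
  "ball_around u = {x. \<exists>\<alpha><s/2. (u, \<alpha>) \<in> anchors len x}"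

definition safe :: "'v point set" where
  "safe = cake_points V E len - (\<Union>u\<in>S. ball_around u)"

lemma safe_subset: "safe \<subseteq> open_cake"
  using s_pos by (auto simp: safe_def open_cake_def ball_around_def)

lemma near_of_pdist:
  assumes "p \<in> safe" "q \<in> safe" "pdist E len p q < ennreal s"
  shows "\<exists>L<s. near p q L"
proof -
  have pq: "p \<in> cake_points V E len" "q \<in> cake_points V E len" "p \<in> open_cake" "q \<in> open_cake"
    using assms safe_subset by (auto simp: safe_def)
  from pdist_less_cases[OF assms(3) len_ge s_pos pq(1,2)] show ?thesis
  proof (elim disjE exE conjE)
    fix e t t' assume a: "p = EPt e t" "q = EPt e t'" "\<bar>t - t'\<bar> < s"
    then have e: "e \<in> E" "0 < t" "t < len e" "0 < t'" "t' < len e" using pq by (auto simp: cake_points_def)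
    then have "seg_in len open_cake e t t'"
      using pt_interior_open_cake[OF e(1)] by (auto simp: seg_in_def closed_segment_eq_real_ivl split: if_splits)
    from near_edge[OF e(1) this] have "near p q \<bar>t - t'\<bar>" using a e by (simp add: edge_pt_def)
    then show ?thesis using a by blast
  next
    fix a \<alpha> \<beta> assume a: "(a, \<alpha>) \<in> anchors len p" "(a, \<beta>) \<in> anchors len q" "\<alpha> + \<beta> < s"
    have "a \<notin> S"
    proof
      assume "a \<in> S"
      \<comment> \<open>Both points avoid the ball around \<open>a\<close>, so each half of the
        connection through \<open>a\<close> has length at least s/2.\<close>
      then have "\<alpha> \<ge> s/2" "\<beta> \<ge> s/2" using assms a by (force simp: safe_def ball_around_def)+
      then show False using a by auto
    qed
    then have "near p q (\<alpha> + \<beta>)"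
      using near_trans[OF near_anchor near_sym[OF near_anchor]] a pq by blast
    then show ?thesis using a by blast
  qed
qed

text \<open>Applied upwards on one side of a turning point and downwards on the other, this bounds
  the distance in the graph by the tree distance.\<close>

lemma dist_le_ups:
  assumes "x \<in> cake_points V E len" "(p, m) \<in> (ups open_cake)\<^sup>*"
  shows "dist_le E len x p L \<Longrightarrow> dist_le E len x m (L + (depth p - depth m))"
    and "dist_le E len x m L \<Longrightarrow> dist_le E len x p (L + (depth p - depth m))"
proof -
  have one: "(dist_le E len x p L \<longrightarrow> dist_le E len x m (L + (depth p - depth m))) \<and>
     (dist_le E len x m L \<longrightarrow> dist_le E len x p (L + (depth p - depth m)))"
    if pm: "(p, m) \<in> ups open_cake" for p m L
  proof -
    obtain e t u where a: "e \<in> E" "t \<in> {0..len e}" "u \<in> {0..len e}"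
      "height e u \<le> height e t" "p = pt e t" "m = pt e u" using pm by (rule upsE)
    have "depth p - depth m = height e t - height e u"
      using a ups_in[OF pm] depth_pt[of e t] depth_pt[of e u] by (auto simp: open_cake_def)
    then have "depth p - depth m = \<bar>t - u\<bar>" using a by (auto simp: height_def split: if_splits)
    then show ?thesis
      using dist_le_step[OF a(1,2,3) len_pos[OF a(1)] assms(1), of L]
        dist_le_step[OF a(1,3,2) len_pos[OF a(1)] assms(1), of L] a
      by (auto simp: abs_minus_commute)
  qed
  have "(\<forall>L. dist_le E len x p L \<longrightarrow> dist_le E len x m (L + (depth p - depth m))) \<and>
     (\<forall>L. dist_le E len x m L \<longrightarrow> dist_le E len x p (L + (depth p - depth m)))"
    using assms(2)
  proof (induction rule: rtrancl_induct)
    case base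
    then show ?case by simp
  next
    case (step m n)
    have "dist_le E len x n (L + (depth p - depth n))" if "dist_le E len x p L" for L
      using one[OF step(2), of "L + (depth p - depth m)"] step(3) that by (auto simp: algebra_simps)
    moreover have "dist_le E len x p (L + (depth p - depth n))" if "dist_le E len x n L" for L
    proof -
      have "dist_le E len x m (L + (depth m - depth n))" using one[OF step(2)] that by blast
      then have "dist_le E len x p (L + (depth m - depth n) + (depth p - depth m))" using step(3) by blast
      then show ?thesis by (simp add: algebra_simps)
    qed
    ultimately show ?case by blast
  qed
  then show "dist_le E len x p L \<Longrightarrow> dist_le E len x m (L + (depth p - depth m))"
    and "dist_le E len x m L \<Longrightarrow> dist_le E len x p (L + (depth p - depth m))" by blast+
qed

lemma pdist_of_near:
  assumes "p \<in> cake_points V E len" "q \<in> cake_points V E len" "near p q L" "L < s"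
  shows "pdist E len p q < ennreal s"
proof -
  obtain m where m: "(p, m) \<in> (ups open_cake)\<^sup>*" "(q, m) \<in> (ups open_cake)\<^sup>*"
    "depth p + depth q - 2 * depth m \<le> L" using assms(3) by (auto simp: near_def)
  from dist_le_ups(2)[OF assms(1) m(2) dist_le_ups(1)[OF assms(1) m(1) dist_le_refl]]
  have "pdist E len p q \<le> ennreal (0 + (depth p - depth m) + (depth q - depth m))"
    using assms len_pos by (intro pdist_le_of_dist_le[of _ V]) (auto intro: less_imp_le)
  also have "\<dots> \<le> ennreal L" using m by (intro ennreal_leI) auto
  also have "\<dots> < ennreal s" by (rule ennreal_lessI[OF s_pos assms(4)])
  finally show ?thesis .
qed

text \<open>The contact is moved from \<open>p\<close> up to \<open>x\<close>, and from
  \<open>q\<close> to a point of \<open>Q\<close> at most \<epsilon> deeper than \<open>x\<close>.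
  The common ancestor \<open>a\<close> of \<open>q\<close> and \<open>z\<close> in \<open>Q\<close>
  is high enough. If the climb to \<open>a\<close> passes the turning point, or passes
  \<open>x\<close> when \<open>x\<close> is above \<open>q\<close>, then that point lies in
  \<open>Q\<close> and is taken instead. The maximum with \<epsilon> covers the case of
  \<open>a\<close> below \<open>x\<close>.\<close>

lemma near_higher:
  assumes Q: "connected_piece E len Q" "Q \<subseteq> open_cake" "q \<in> Q" "z \<in> Q"
    and px: "(p, x) \<in> (ups open_cake)\<^sup>*" and "near p q L" "depth z \<le> depth x + \<epsilon>" "0 \<le> \<epsilon>"
  obtains q' m where "q' \<in> Q" "(x, m) \<in> (ups open_cake)\<^sup>*" "(q', m) \<in> (ups open_cake)\<^sup>*"
    "depth q' \<le> depth x + \<epsilon>" "depth x + depth q' - 2 * depth m \<le> max L \<epsilon>"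
proof -
  obtain m where m: "(p, m) \<in> (ups open_cake)\<^sup>*" "(q, m) \<in> (ups open_cake)\<^sup>*"
    "depth p + depth q - 2 * depth m \<le> L" using assms(6) by (auto simp: near_def)
  obtain a where a: "a \<in> Q" "(q, a) \<in> (ups Q)\<^sup>*" "(z, a) \<in> (ups Q)\<^sup>*"
    using connected_common_ancestor[OF Q] by blast
  have lift: "(u, w) \<in> (ups open_cake)\<^sup>*" if "(u, w) \<in> (ups Q)\<^sup>*" for u w
    using that rtrancl_mono[OF ups_mono[OF Q(2)]] by blast
  have da: "depth a \<le> depth x + \<epsilon>" "depth a \<le> depth q"
    using depth_mono[OF lift[OF a(3)]] depth_mono[OF lift[OF a(2)]] assms(7) by auto
  have dx: "depth x \<le> depth p" "depth m \<le> depth p" "depth m \<le> depth q" using depth_mono px m by auto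
  from ups_comparable[OF subset_refl subset_refl px m(1)] show ?thesis
  proof
    assume xm: "(x, m) \<in> (ups open_cake)\<^sup>*"
    from ups_comparable[OF Q(2) subset_refl a(2) m(2)] show ?thesis
    proof
      assume "(a, m) \<in> (ups open_cake)\<^sup>*"
      then show ?thesis using that[of a m] a xm da dx m(3) by auto
    next
      assume "(m, a) \<in> (ups Q)\<^sup>*"
      then have "m \<in> Q" using ups_rtrancl_in' a by blast
      then show ?thesis using that[of m m] xm depth_mono[OF xm] dx m(3) assms(8) by auto
    qed
  next
    assume "(m, x) \<in> (ups open_cake)\<^sup>*"
    then have qx: "(q, x) \<in> (ups open_cake)\<^sup>*" using m by simp
    from ups_comparable[OF Q(2) subset_refl a(2) qx] show ?thesis
    proof
      assume "(a, x) \<in> (ups open_cake)\<^sup>*"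
      then show ?thesis using that[of a x] a da by auto
    next
      assume "(x, a) \<in> (ups Q)\<^sup>*"
      then have "x \<in> Q" using ups_rtrancl_in' a by blast
      then show ?thesis using that[of x x] assms(8) by auto
    qed
  qed
qed

text \<open>A common ancestor \<open>x\<close> inside \<open>P\<close> of the two contact points
  \<open>p\<close> and \<open>p'\<close> plays the part of a highest point, which \<open>P\<close>
  may lack.\<close>

lemma near_common_neighbours:
  assumes P: "connected_piece E len P" "P \<subseteq> open_cake" "p \<in> P" "p' \<in> P"
    and Q: "connected_piece E len Q" "Q \<subseteq> open_cake" "q \<in> Q" "near p q L" "L < s"
    and Q': "connected_piece E len Q'" "Q' \<subseteq> open_cake" "q' \<in> Q'" "near p' q' L'" "L' < s"
    and high: "\<And>x \<epsilon>. x \<in> P \<Longrightarrow> \<epsilon> > 0 \<Longrightarrow> \<exists>z\<in>Q. depth z < depth x + \<epsilon>"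
      "\<And>x \<epsilon>. x \<in> P \<Longrightarrow> \<epsilon> > 0 \<Longrightarrow> \<exists>z\<in>Q'. depth z < depth x + \<epsilon>"
  shows "\<exists>a\<in>Q. \<exists>b\<in>Q'. \<exists>M<s. near a b M"
proof -
  obtain x where x: "x \<in> P" "(p, x) \<in> (ups P)\<^sup>*" "(p', x) \<in> (ups P)\<^sup>*"
    using connected_common_ancestor[OF P] by blast
  have px: "(p, x) \<in> (ups open_cake)\<^sup>*" "(p', x) \<in> (ups open_cake)\<^sup>*"
    using x rtrancl_mono[OF ups_mono[OF P(2)]] by blast+
  \<comment> \<open>The bound s/3 gives 2\<epsilon> < s when the maximum below is \<epsilon>; the
    other two give \<epsilon> + L < s and \<epsilon> + L' < s.\<close>
  define \<epsilon> where "\<epsilon> = min (s/3) (min ((s - L)/2) ((s - L')/2))"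
  have e: "\<epsilon> > 0" "\<epsilon> + max L \<epsilon> < s" "\<epsilon> + max L' \<epsilon> < s"
    using s_pos Q(5) Q'(5) by (auto simp: \<epsilon>_def min_def max_def field_simps)
  obtain z z' where z: "z \<in> Q" "depth z \<le> depth x + \<epsilon>" "z' \<in> Q'" "depth z' \<le> depth x + \<epsilon>"
    using high[OF x(1) e(1)] by (meson less_imp_le)
  obtain a m where a: "a \<in> Q" "(x, m) \<in> (ups open_cake)\<^sup>*" "(a, m) \<in> (ups open_cake)\<^sup>*"
    "depth a \<le> depth x + \<epsilon>" "depth x + depth a - 2 * depth m \<le> max L \<epsilon>"
    by (rule near_higher[OF Q(1,2,3) z(1) px(1) Q(4) z(2) less_imp_le[OF e(1)]])
  obtain b m' where b: "b \<in> Q'" "(x, m') \<in> (ups open_cake)\<^sup>*" "(b, m') \<in> (ups open_cake)\<^sup>*"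
    "depth b \<le> depth x + \<epsilon>" "depth x + depth b - 2 * depth m' \<le> max L' \<epsilon>"
    by (rule near_higher[OF Q'(1,2,3) z(3) px(2) Q'(4) z(4) less_imp_le[OF e(1)]])
  from ups_comparable[OF subset_refl subset_refl a(2) b(2)] show ?thesis
  proof
    assume "(m, m') \<in> (ups open_cake)\<^sup>*"
    then have "(a, m') \<in> (ups open_cake)\<^sup>*" using a by simp
    then have "near a b (\<epsilon> + max L' \<epsilon>)" unfolding near_def using a b by (intro exI[of _ m']) auto
    then show ?thesis using a b e by blast
  next
    assume "(m', m) \<in> (ups open_cake)\<^sup>*"
    then have "(b, m) \<in> (ups open_cake)\<^sup>*" using b by simp
    then have "near a b (\<epsilon> + max L \<epsilon>)" unfolding near_def using a b by (intro exI[of _ m]) auto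
    then show ?thesis using a b e by blast
  qed
qed

lemma depth_bdd_below: "bdd_below (depth ` cake_points V E len)"
proof (rule bdd_belowI2)
  fix x assume x: "x \<in> cake_points V E len"
  have fin: "finite V" using graph by (auto simp: metric_graph_def)
  show "Min (dv ` V) \<le> depth x"
  proof (cases x)
    case (Vtx u)
    then show ?thesis using x fin by (auto simp: cake_points_def)
  next
    case (EPt e t)
    then have "e \<in> E" "height e t \<ge> 0" using x by (auto simp: cake_points_def height_def)
    moreover have "upper up e \<in> V" using edge_in_V[OF \<open>e \<in> E\<close>] by (auto simp: upper_def)
    ultimately have "Min (dv ` V) \<le> dv (upper up e)" using fin by auto
    then show ?thesis using EPt \<open>height e t \<ge> 0\<close> by simp
  qed
qed

lemma exists_higher:
  assumes "P \<subseteq> cake_points V E len" "Q \<noteq> {}" "Inf (depth ` Q) \<le> Inf (depth ` P)"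
    "x \<in> P" "\<epsilon> > 0"
  shows "\<exists>z\<in>Q. depth z < depth x + \<epsilon>"
proof -
  have "Inf (depth ` P) \<le> depth x"
    using assms by (intro cInf_lower bdd_below_mono[OF depth_bdd_below]) auto
  then have "Inf (depth ` Q) < depth x + \<epsilon>" using assms by linarith
  then show ?thesis using cInf_lessD[of "depth ` Q"] assms(2) by auto
qed

lemma sep_iff:
  "sep_family V E len s k P \<longleftrightarrow>
    (\<forall>j<k. is_piece V E len (P j) \<and> connected_piece E len (P j)) \<and>
    (\<forall>i<k. \<forall>j<k. i \<noteq> j \<longrightarrow> (\<forall>x\<in>P i. \<forall>y\<in>P j. ennreal s \<le> pdist E len x y))"
  using len_pos by (intro sep_family_iff s_pos) (auto intro: less_imp_le)

text \<open>Each unsafe piece is charged to a vertex of \<open>S\<close> whose ball it meets. No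
  vertex is charged twice, since two points of one ball are closer than s/2 + s/2.\<close>

lemma safe_pieces:
  assumes "sep_family V E len s k P" "finite S"
  shows "k \<le> card {j. j < k \<and> P j \<subseteq> safe} + card S"
proof -
  have sep: "\<And>i j x y. i < k \<Longrightarrow> j < k \<Longrightarrow> i \<noteq> j \<Longrightarrow> x \<in> P i \<Longrightarrow> y \<in> P j \<Longrightarrow> ennreal s \<le> pdist E len x y"
    and piece: "\<And>j. j < k \<Longrightarrow> P j \<subseteq> cake_points V E len"
    using assms(1) unfolding sep_iff
    by (auto simp: is_piece_def)
  define B where "B = {j. j < k \<and> \<not> P j \<subseteq> safe}"
  have "\<exists>u\<in>S. \<exists>x\<in>P j. x \<in> ball_around u" if "j \<in> B" for j
    using that piece[of j] by (auto simp: B_def safe_def)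
  then obtain f where f: "\<And>j. j \<in> B \<Longrightarrow> f j \<in> S \<and> (\<exists>x\<in>P j. x \<in> ball_around (f j))" by metis
  have "inj_on f B"
  proof (rule inj_onI, rule ccontr)
    fix i j assume ij: "i \<in> B" "j \<in> B" "f i = f j" "i \<noteq> j"
    then obtain x y where xy: "x \<in> P i" "x \<in> ball_around (f i)" "y \<in> P j" "y \<in> ball_around (f i)"
      using f by metis
    then obtain \<alpha> \<beta> where ab: "(f i, \<alpha>) \<in> anchors len x" "(f i, \<beta>) \<in> anchors len y" "\<alpha> < s/2" "\<beta> < s/2"
      by (auto simp: ball_around_def)
    have cake: "x \<in> cake_points V E len" "y \<in> cake_points V E len" "i < k" "j < k"
      using xy ij piece by (auto simp: B_def)
    have "vertex_within E len x (f i) (\<alpha> + \<beta> - \<beta>)"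
      unfolding vertex_within_def using ab by (intro exI[of _ "f i"] exI[of _ \<alpha>] exI[of _ 0]) (auto intro: walk.walk_nil)
    then have "dist_le E len x y (\<alpha> + \<beta>)" unfolding dist_le_def using ab by blast
    then have "pdist E len x y \<le> ennreal (\<alpha> + \<beta>)"
      using cake len_pos by (intro pdist_le_of_dist_le[of _ V]) (auto intro: less_imp_le)
    also have "\<dots> < ennreal s" using ab by (intro ennreal_lessI s_pos) auto
    finally show False using sep[OF cake(3,4) ij(4) xy(1,3)] by simp
  qed
  then have "card B \<le> card S" using f assms(2) by (intro card_inj_on_le) auto
  moreover have "{..<k} = {j. j < k \<and> P j \<subseteq> safe} \<union> B" by (auto simp: B_def)
  then have "card {..<k} = card {j. j < k \<and> P j \<subseteq> safe} + card B"
    by (simp only:) (intro card_Un_disjoint, auto simp: B_def)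
  ultimately show ?thesis by simp
qed

text \<open>Conflict is expressed by \<open>near\<close>. A conflict forces distance below
  \<open>s\<close> anywhere in the cake; the converse is available for safe points, which is why
  only safe pieces are offered to the greedy choice.\<close>

lemma sep_choice:
  fixes P :: "nat \<Rightarrow> nat \<Rightarrow> 'v point set"
  assumes fam: "\<And>i. i < n \<Longrightarrow> sep_family V E len s k (P i)" and "finite S" "n + card S \<le> k"
  shows "\<exists>f. (\<forall>i<n. f i < k) \<and> sep_family V E len s n (\<lambda>i. P i (f i))"
proof -
  define J where "J i = {j. j < k \<and> P i j \<subseteq> safe}" for i
  define conf where "conf i p j q \<longleftrightarrow> (\<exists>a\<in>P i p. \<exists>b\<in>P j q. \<exists>L<s. near a b L)" for i p j q
  have conn: "connected_piece E len (P i j)" "is_piece V E len (P i j)" if "i < n" "j < k" for i j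
    using fam[OF that(1)] that(2) by (auto simp: sep_family_def)
  have "\<exists>f. (\<forall>i\<in>{..<n}. f i \<in> J i) \<and> (\<forall>i\<in>{..<n}. \<forall>j\<in>{..<n}. i \<noteq> j \<longrightarrow> \<not> conf i (f i) j (f j))"
  proof (rule greedy_choice[where h = "\<lambda>i j. Inf (depth ` P i j)"])
    fix i assume "i \<in> {..<n}"
    then show "finite (J i) \<and> card {..<n} \<le> card (J i)"
      using safe_pieces[OF fam assms(2), of i] assms(3) by (auto simp: J_def)
  next
    fix i p j q assume "conf i p j q"
    then show "conf j q i p" unfolding conf_def using near_sym by blast
  next
    fix i j p q q'
    assume ij: "i \<in> {..<n}" "j \<in> {..<n}" and pq: "p \<in> J i" "q \<in> J j" "q' \<in> J j"
      and h: "Inf (depth ` P j q) \<le> Inf (depth ` P i p)" "Inf (depth ` P j q') \<le> Inf (depth ` P i p)"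
      and c: "conf i p j q" "conf i p j q'"
    have sub: "P i p \<subseteq> open_cake" "P j q \<subseteq> open_cake" "P j q' \<subseteq> open_cake"
      "P i p \<subseteq> cake_points V E len" "P j q \<subseteq> cake_points V E len" "P j q' \<subseteq> cake_points V E len"
      using pq safe_subset by (auto simp: J_def open_cake_def)
    have k: "i < n" "j < n" "p < k" "q < k" "q' < k" using ij pq by (auto simp: J_def)
    obtain a b L where 1: "a \<in> P i p" "b \<in> P j q" "L < s" "near a b L" using c(1) by (auto simp: conf_def)
    obtain a' b' L' where 2: "a' \<in> P i p" "b' \<in> P j q'" "L' < s" "near a' b' L'" using c(2) by (auto simp: conf_def)
    \<comment> \<open>Pieces in conflict contain points, so \<open>Inf\<close> is a genuine infimum
      for each of them.\<close>
    have "\<exists>z\<in>P j q. depth z < depth x + \<epsilon>" "\<exists>z\<in>P j q'. depth z < depth x + \<epsilon>"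
      if "x \<in> P i p" "\<epsilon> > 0" for x \<epsilon>
      using exists_higher[OF sub(4) _ h(1) that] exists_higher[OF sub(4) _ h(2) that] 1 2 by blast+
    from near_common_neighbours[OF conn(1)[OF k(1,3)] sub(1) 1(1) 2(1) conn(1)[OF k(2,4)] sub(2) 1(2,4,3)
        conn(1)[OF k(2,5)] sub(3) 2(2,4,3) this]
    obtain x y M where xy: "x \<in> P j q" "y \<in> P j q'" "M < s" "near x y M" by blast
    then have "pdist E len x y < ennreal s" using pdist_of_near sub by blast
    then show "q = q'" using fam[OF k(2)] k xy unfolding sep_iff by (meson not_le)
  qed simp
  then obtain f where f: "\<And>i. i < n \<Longrightarrow> f i \<in> J i" "\<And>i j. i < n \<Longrightarrow> j < n \<Longrightarrow> i \<noteq> j \<Longrightarrow> \<not> conf i (f i) j (f j)"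
    by auto
  have "sep_family V E len s n (\<lambda>i. P i (f i))"
    unfolding sep_iff
  proof (intro conjI allI impI ballI)
    fix i assume "i < n"
    then show "is_piece V E len (P i (f i))" "connected_piece E len (P i (f i))"
      using conn f(1) by (auto simp: J_def)
  next
    fix i j x y assume a: "i < n" "j < n" "i \<noteq> j" "x \<in> P i (f i)" "y \<in> P j (f j)"
    have "x \<in> safe" "y \<in> safe" using f(1) a by (auto simp: J_def)
    show "ennreal s \<le> pdist E len x y"
    proof (rule ccontr)
      assume "\<not> ?thesis"
      then have "\<exists>L<s. near x y L" using near_of_pdist \<open>x \<in> safe\<close> \<open>y \<in> safe\<close> by simp
      then show False using f(2)[OF a(1,2,3)] a by (auto simp: conf_def)
    qed
  qed
  then show ?thesis using f(1) by (auto simp: J_def)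
qed

end

section \<open>Choosing the feedback vertex set and rooting its complement\<close>

lemma FvsNum_witness:
  assumes "finite V"
  obtains S where "S \<subseteq> V" "\<not> (\<exists>cs. is_cycle E (V - S) cs)" "card S = FvsNum V E"
proof -
  define C where "C = {S. S \<subseteq> V \<and> \<not> (\<exists>cs. is_cycle E (V - S) cs)}"
  have "finite (card ` C)" using assms by (auto simp: C_def)
  \<comment> \<open>Removing every vertex leaves no cycle, so the minimum is over a nonempty
    set.\<close>
  moreover have "V \<in> C" by (auto simp: C_def is_cycle_def)
  ultimately have "Min (card ` C) \<in> card ` C" by (intro Min_in) auto
  then show ?thesis using that by (auto simp: FvsNum_def C_def)
qed

lemma rooted_forest_exists:
  assumes graph: "metric_graph V E len" and "s > 0" "\<forall>e\<in>E. len e \<ge> s"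
    and "\<not> (\<exists>cs. is_cycle E (V - S) cs)"
  shows "\<exists>up dv. rooted_forest V E len s S up dv"
proof -
  define W where "W = V - S"
  have W: "finite W" "\<not> (\<exists>cs. is_cycle E W cs)" "\<forall>(a,b)\<in>E. a \<noteq> b \<and> (b,a) \<notin> E"
    using assms by (auto simp: W_def metric_graph_def)
  obtain up d where
    ud: "\<And>e. e \<in> E \<inter> W \<times> W \<Longrightarrow> d (lower up e) = d (upper up e) + len e"
      "\<And>e e'. e \<in> E \<inter> W \<times> W \<Longrightarrow> e' \<in> E \<inter> W \<times> W \<Longrightarrow> lower up e = lower up e' \<Longrightarrow> e = e'"
    using forest_orientation[OF W, of len] by blast
  \<comment> \<open>An edge that touches \<open>S\<close> is turned so that its lower end lies in
    \<open>S\<close>, where \<open>lower_depth\<close> and \<open>lower_unique\<close> are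
    vacuous.\<close>
  define up' where "up' e = (if e \<in> W \<times> W then up e else snd e \<in> S)" for e
  have EV: "fst e \<in> V" "snd e \<in> V" if "e \<in> E" for e using graph that by (auto simp: metric_graph_def)
  have low: "e \<in> E \<inter> W \<times> W \<and> lower up' e = lower up e \<and> upper up' e = upper up e"
    if "e \<in> E" "lower up' e \<notin> S" for e
    using that EV[OF that(1)] by (cases e) (auto simp: up'_def lower_def upper_def W_def split: if_splits)
  have upW: "upper up e \<notin> S" if "e \<in> W \<times> W" for e using that by (auto simp: upper_def W_def)
  have "rooted_forest V E len s S up' d"
  proof (unfold_locales)
    show "lower up' e \<notin> S \<Longrightarrow> upper up' e \<notin> S \<and> d (lower up' e) = d (upper up' e) + len e" if "e \<in> E" for e
      using low[OF that] ud(1) upW by auto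
    show "lower up' e = lower up' e' \<Longrightarrow> lower up' e \<notin> S \<Longrightarrow> e = e'" if "e \<in> E" "e' \<in> E" for e e'
      using low[OF that(1)] low[OF that(2)] ud(2)[of e e'] by auto
  qed (use assms in auto)
  then show ?thesis by blast
qed

theorem theorem4:
  fixes V :: "'v set" and E :: "('v \<times> 'v) set" and len :: "'v \<times> 'v \<Rightarrow> real"
    and s :: real and n :: nat and v :: "nat \<Rightarrow> 'v point set \<Rightarrow> real"
  assumes "metric_graph V E len"
    and "s > 0"
    and "\<forall>e\<in>E. len e \<ge> s"
    and "n \<ge> 1"
    and "\<forall>i<n. valuation V E len (v i)"
  shows "\<exists>A. sep_family V E len s n A \<and>
           (\<forall>i<n. MMS V E len (v i) (n + FvsNum V E) s \<le> v i (A i))"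
proof -
  define k where "k = n + FvsNum V E"
  have fin: "finite V" using assms(1) by (simp add: metric_graph_def)
  obtain S where S: "S \<subseteq> V" "\<not> (\<exists>cs. is_cycle E (V - S) cs)" "card S = FvsNum V E"
    using FvsNum_witness[OF fin] by blast
  obtain up dv where "rooted_forest V E len s S up dv"
    using rooted_forest_exists[OF assms(1-3) S(2)] by blast
  then interpret rooted_forest V E len s S up dv .
  have "\<exists>P. sep_family V E len s k P \<and> (\<forall>j<k. MMS V E len (v i) k s \<le> v i (P j))" if "i < n" for i
    using MMS_attained[OF assms(1,2), of "v i" k] assms(4,5) that by (metis k_def trans_le_add1)
  then obtain P where P: "\<And>i. i < n \<Longrightarrow> sep_family V E len s k (P i)"
    "\<And>i j. i < n \<Longrightarrow> j < k \<Longrightarrow> MMS V E len (v i) k s \<le> v i (P i j)" by metis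
  have "n + card S \<le> k" by (simp add: k_def S)
  with sep_choice[of n k P] P(1) finite_subset[OF S(1) fin]
  obtain f where "\<forall>i<n. f i < k" "sep_family V E len s n (\<lambda>i. P i (f i))" by blast
  then show ?thesis using P(2) unfolding k_def by blast
qed

end
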